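(* (1) Assume $$\mathcal{K}=\bigoplus_{j=1}^N\Big(\bigoplus_{k=1}^{m_j}\begin{bmatrix}0&\sigma_j\\-\sigma_j&0\end{bmatrix}\Big)\oplus0_M,$$ in which $\sigma_1,\ldots,\sigma_N\in\mathbb{R}\setminus\{0\}$ are pairwise distinct, and set $n:=M+\sum_{j=1}^N2m_j$. Then $\Sigma_{\mathcal{K}}\cap\mathrm{O}_n(\mathbb{R})$ is real conjugate (by a permutation matrix) to $$\bigoplus_{j=1}^N\Big\{\begin{bmatrix}\mathrm{Re}(Q)&\mathrm{Im}(Q)\\-\mathrm{Im}(Q)&\mathrm{Re}(Q)\end{bmatrix}\ \Big|\ Q\in\mathrm{U}(m_j)\Big\}\oplus\mathrm{O}_M(\mathbb{R})\subset\mathbb{R}^{n\times n}.$$ In particular, $\Sigma_{\mathcal{K}}\cap\mathrm{O}_n(\mathbb{R})$ is isomorphic to $\bigoplus_{j=1}^N\mathrm{U}(m_j)\oplus\mathrm{O}_M(\mathbb{R})$. (2) Suppose $$\mathcal{O}=\bigoplus_{j=1}^N\Big(\bigoplus_{k=1}^{m_j}\begin{bmatrix}\cos(\varphi_j)&\sin(\varphi_j)\\-\sin(\varphi_j)&\cos(\varphi_j)\end{bmatrix}\Big)\oplus I_{M_1}\oplus(-I_{M_2}),$$ in which $\varphi_1,\ldots,\varphi_N\in\mathbb{R}\setminus\{k\pi\}_{k\in\mathbb{Z}}$ are pairwise distinct, and set $n:=M_1+M_2+\sum_{j=1}^N2m_j$. Then $\Sigma_{\mathcal{O}}\cap\mathrm{O}_n(\mathbb{R})$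 is real conjugate (by a permutation matrix) to $$\bigoplus_{j=1}^N\Big\{\begin{bmatrix}\mathrm{Re}(Q)&\mathrm{Im}(Q)\\-\mathrm{Im}(Q)&\mathrm{Re}(Q)\end{bmatrix}\ \Big|\ Q\in\mathrm{U}(m_j)\Big\}\oplus\mathrm{O}_{M_1}(\mathbb{R})\oplus\mathrm{O}_{M_2}(\mathbb{R})\subset\mathbb{R}^{n\times n}.$$ In particular, $\Sigma_{\mathcal{O}}\cap\mathrm{O}_n(\mathbb{R})$ is isomorphic to $\bigoplus_{j=1}^N\mathrm{U}(m_j)\oplus\mathrm{O}_{M_1}(\mathbb{R})\oplus\mathrm{O}_{M_2}(\mathbb{R})$.
   Context: $\mathrm{O}_n(\mathbb{C})=\{Q\in\mathrm{GL}_n(\mathbb{C})\mid Q^{-1}=Q^T\}$, $\mathrm{O}_n(\mathbb{R})$ is its subgroup of real matrices, and $\mathrm{U}(m)$ is the unitary group of $m\times m$ matrices. For an $n\times n$ complex skew-symmetric or complex orthogonal matrix $M$, the isotropy group under orthogonal similarity is $\Sigma_M:=\{Q\in\mathrm{O}_n(\mathbb{C})\mid Q^TMQ=M\}$. In the statement the $m_j$ are positive integers and $M,M_1,M_2$ are nonnegative integers; $0_M$ is the $M\times M$ zero matrix and $I_M$ the $M\times M$ identity. A direct sum of sets of matrices is the set of all block diagonal matrices with blocks from the respective sets. $\mathrm{Re}(Q)$ and $\mathrm{Im}(Q)$ are the entrywise real and imaginary parts of $Q$.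
   Formalization: "Pairwise distinct" is strengthened: σ_i ≠ ±σ_j, and φ_i ≠ ±φ_j modulo 2π, for i ≠ j. As stated the claim fails, e.g. σ = (1, −1), m_1 = m_2 = 1, M = 0 gives a group isomorphic to U(2), not U(1)⊕U(1); likewise φ_2 = −φ_1 or φ_2 = φ_1 + 2π. *)

theory Defs
  imports "Jordan_Normal_Form.Schur_Decomposition"
begin

text \<open>All matrices are over the complex numbers; real matrices are the complex matrices all of
  whose entries lie in \<open>\<real>\<close>.\<close>

definition real_matrices :: "nat \<Rightarrow> complex mat set" where
  "real_matrices n = {A \<in> carrier_mat n n. elements_mat A \<subseteq> \<real>}"

definition complex_orthogonal :: "nat \<Rightarrow> complex mat set" where
  "complex_orthogonal n =
     {Q \<in> carrier_mat n n. inverts_mat Q (transpose_mat Q) \<and> inverts_mat (transpose_mat Q) Q}"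

definition real_orthogonal :: "nat \<Rightarrow> complex mat set" where
  "real_orthogonal n = complex_orthogonal n \<inter> real_matrices n"

definition unitary_matrices :: "nat \<Rightarrow> complex mat set" where
  "unitary_matrices n =
     {Q \<in> carrier_mat n n. inverts_mat Q (mat_adjoint Q) \<and> inverts_mat (mat_adjoint Q) Q}"

definition isotropy :: "nat \<Rightarrow> complex mat \<Rightarrow> complex mat set" where
  "isotropy n A = {Q \<in> complex_orthogonal n. transpose_mat Q * A * Q = A}"

text \<open>The direct sum of a list of sets of matrices: all block diagonal matrices whose \<open>i\<close>-th
  diagonal block lies in the \<open>i\<close>-th set.\<close>

definition set_direct_sum :: "complex mat set list \<Rightarrow> complex mat set" where
  "set_direct_sum Ss = diag_block_mat ` listset Ss"

definition Re_mat :: "complex mat \<Rightarrow> complex mat" where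
  "Re_mat = map_mat (\<lambda>z. complex_of_real (Re z))"

definition Im_mat :: "complex mat \<Rightarrow> complex mat" where
  "Im_mat = map_mat (\<lambda>z. complex_of_real (Im z))"

definition realified_unitary :: "nat \<Rightarrow> complex mat set" where
  "realified_unitary m =
     {four_block_mat (Re_mat Q) (Im_mat Q) (- Im_mat Q) (Re_mat Q) | Q. Q \<in> unitary_matrices m}"

definition permutation_matrix :: "nat \<Rightarrow> complex mat \<Rightarrow> bool" where
  "permutation_matrix n P \<longleftrightarrow>
     (\<exists>p. p permutes {..<n} \<and> P = mat n n (\<lambda>(i, j). if i = p j then 1 else 0))"

text \<open>\<open>S = P\<inverse> T P\<close> for one (automatically real) permutation matrix \<open>P\<close>, with \<open>R = P\<inverse>\<close>.\<close>

definition permutation_conjugate :: "nat \<Rightarrow> complex mat set \<Rightarrow> complex mat set \<Rightarrow> bool" where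
  "permutation_conjugate n S T \<longleftrightarrow>
     (\<exists>P R. permutation_matrix n P \<and> R \<in> carrier_mat n n \<and> inverts_mat P R \<and> inverts_mat R P \<and>
        S = (\<lambda>X. R * X * P) ` T)"

definition matrix_group :: "nat \<Rightarrow> complex mat set \<Rightarrow> complex mat monoid" where
  "matrix_group n S = \<lparr>carrier = S, monoid.mult = (*), one = 1\<^sub>m n\<rparr>"

definition skew_block :: "real \<Rightarrow> complex mat" where
  "skew_block s = mat_of_rows_list 2 [[0, of_real s], [- of_real s, 0]]"

definition rotation_block :: "real \<Rightarrow> complex mat" where
  "rotation_block t =
     mat_of_rows_list 2 [[of_real (cos t), of_real (sin t)], [- of_real (sin t), of_real (cos t)]]"

definition skew_normal_form :: "nat \<Rightarrow> (nat \<Rightarrow> nat) \<Rightarrow> (nat \<Rightarrow> real) \<Rightarrow> nat \<Rightarrow> complex mat" where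
  "skew_normal_form N m \<sigma> M = diag_block_mat
     (map (\<lambda>j. diag_block_mat (replicate (m j) (skew_block (\<sigma> j)))) [1..<Suc N] @ [0\<^sub>m M M])"

definition orthogonal_normal_form ::
  "nat \<Rightarrow> (nat \<Rightarrow> nat) \<Rightarrow> (nat \<Rightarrow> real) \<Rightarrow> nat \<Rightarrow> nat \<Rightarrow> complex mat" where
  "orthogonal_normal_form N m \<phi> M1 M2 = diag_block_mat
     (map (\<lambda>j. diag_block_mat (replicate (m j) (rotation_block (\<phi> j)))) [1..<Suc N]
      @ [1\<^sub>m M1, - 1\<^sub>m M2])"

text \<open>Since \<open>skew_block (- s)\<close> is permutation similar to \<open>skew_block s\<close>, the blocks of the normal
  form are determined only up to the sign of the parameter. Distinctness of the parameters therefore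
  has to be read up to sign: for \<open>\<sigma> 2 = - \<sigma> 1\<close> the two families of blocks merge and the isotropy
  group contains a factor \<open>U(m 1 + m 2)\<close> instead of \<open>U(m 1) \<oplus> U(m 2)\<close>.\<close>

definition distinct_skew_parameters :: "nat \<Rightarrow> (nat \<Rightarrow> real) \<Rightarrow> bool" where
  "distinct_skew_parameters N \<sigma> \<longleftrightarrow>
     (\<forall>i\<in>{1..N}. \<forall>j\<in>{1..N}. i \<noteq> j \<longrightarrow> \<sigma> i \<noteq> \<sigma> j \<and> \<sigma> i \<noteq> - \<sigma> j)"

text \<open>Likewise, rotation angles are distinct only if they differ up to sign and modulo \<open>2\<pi>\<close>.\<close>

definition distinct_rotation_angles :: "nat \<Rightarrow> (nat \<Rightarrow> real) \<Rightarrow> bool" where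
  "distinct_rotation_angles N \<phi> \<longleftrightarrow>
     (\<forall>i\<in>{1..N}. \<forall>j\<in>{1..N}. i \<noteq> j \<longrightarrow>
        (\<forall>k::int. \<phi> i \<noteq> \<phi> j + 2 * pi * of_int k \<and> \<phi> i \<noteq> - \<phi> j + 2 * pi * of_int k))"

end

theory Submission
  imports Defs
begin

text \<open>
Both normal forms are instances of one family. Write \<open>\<rho>(Q)\<close> for the real \<open>2m \<times> 2m\<close> matrix with
blocks \<open>Re Q\<close>, \<open>Im Q\<close>, \<open>- Im Q\<close>, \<open>Re Q\<close>. The two-by-two blocks in the statement are \<open>\<rho>(z)\<close> for
a nonreal number \<open>z\<close>, namely \<open>z = \<i>\<sigma>\<close> and \<open>z = e\<^sup>i\<^sup>\<phi>\<close>, and the remaining blocks are real scalar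
matrices. Reading \<open>m\<close> copies of \<open>\<rho>(z)\<close> with all first coordinates before all second coordinates
turns their direct sum into \<open>\<rho>(z I\<^sub>m)\<close> (\<open>perm_similar_realify_scalar\<close>); conjugation by that
permutation matrix carries one isotropy group to the other.

For the rearranged matrix \<open>K\<close> the isotropy group can be read off. A real orthogonal \<open>X\<close> with
\<open>X\<^sup>T K X = K\<close> commutes with \<open>K\<close> and also with \<open>K\<^sup>T\<close>, hence with \<open>K + K\<^sup>T\<close> and \<open>K\<^sup>T K\<close>. On
\<open>\<rho>(z I)\<close> these two are the scalars \<open>2 Re z\<close> and \<open>|z|\<^sup>2\<close>, and on \<open>c I\<close> they are \<open>2 c\<close> and \<open>c\<^sup>2\<close>.
The hypotheses on the parameters say that different blocks have different pairs of scalars, so the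
blocks of \<open>X\<close> off the diagonal vanish (\<open>real_isotropy_diag_block_mat\<close>), and each diagonal block
of \<open>X\<close> lies in the isotropy group of the corresponding block of \<open>K\<close>.

It remains to look at a single block. Everything commutes with \<open>c I\<close>. For nonreal \<open>z\<close>, commuting
with \<open>\<rho>(z I)\<close> means commuting with \<open>\<rho>(\<i> I)\<close>, which forces the shape \<open>\<rho>(Q)\<close>. As \<open>\<rho>\<close> is an injective
ring homomorphism that takes adjoints to transposes, \<open>\<rho>(Q)\<close> is orthogonal iff \<open>Q\<close> is unitary
(\<open>real_isotropy_realify_scalar\<close>), and the inverse of \<open>\<rho>\<close>, applied block by block, is the
isomorphism with the direct sum of unitary groups.
\<close>

section \<open>Block matrices and two-term direct sums\<close>

lemma real_orthogonal_iff:
  "Q \<in> real_orthogonal n \<longleftrightarrow> Q \<in> carrier_mat n n \<and> Q * Q\<^sup>T = 1\<^sub>m n \<and> Q\<^sup>T * Q = 1\<^sub>m n \<and>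
     elements_mat Q \<subseteq> \<real>"
  by (auto simp: real_orthogonal_def complex_orthogonal_def real_matrices_def inverts_mat_def)

lemma real_orthogonal_carrier: "real_orthogonal n \<subseteq> carrier_mat n n"
  by (auto simp: real_orthogonal_iff)

lemma elements_mat_subset_iff:
  assumes "A \<in> carrier_mat nr nc"
  shows "elements_mat A \<subseteq> S \<longleftrightarrow> (\<forall>i<nr. \<forall>j<nc. A $$ (i,j) \<in> S)"
  using assms by (fastforce simp: elements_mat_def)

lemma four_block_mat_inject:
  assumes "A \<in> carrier_mat r1 c1" "B \<in> carrier_mat r1 c2" "C \<in> carrier_mat r2 c1" "D \<in> carrier_mat r2 c2"
    and "A' \<in> carrier_mat r1 c1" "B' \<in> carrier_mat r1 c2" "C' \<in> carrier_mat r2 c1" "D' \<in> carrier_mat r2 c2"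
  shows "four_block_mat A B C D = four_block_mat A' B' C' D' \<longleftrightarrow> A = A' \<and> B = B' \<and> C = C' \<and> D = D'"
proof
  assume eq: "four_block_mat A B C D = four_block_mat A' B' C' D'"
  have ix: "four_block_mat A B C D $$ ij = four_block_mat A' B' C' D' $$ ij" for ij
    using eq by simp
  have "A = A'"
  proof (rule eq_matI)
    show "A $$ (i,j) = A' $$ (i,j)" if "i < dim_row A'" "j < dim_col A'" for i j
      using ix[of "(i,j)"] assms that by auto
  qed (use assms in auto)
  moreover have "B = B'"
  proof (rule eq_matI)
    show "B $$ (i,j) = B' $$ (i,j)" if "i < dim_row B'" "j < dim_col B'" for i j
      using ix[of "(i,j+c1)"] assms that by auto
  qed (use assms in auto)
  moreover have "C = C'"
  proof (rule eq_matI)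
    show "C $$ (i,j) = C' $$ (i,j)" if "i < dim_row C'" "j < dim_col C'" for i j
      using ix[of "(i+r1,j)"] assms that by auto
  qed (use assms in auto)
  moreover have "D = D'"
  proof (rule eq_matI)
    show "D $$ (i,j) = D' $$ (i,j)" if "i < dim_row D'" "j < dim_col D'" for i j
      using ix[of "(i+r1,j+c1)"] assms that by auto
  qed (use assms in auto)
  ultimately show "A = A' \<and> B = B' \<and> C = C' \<and> D = D'" by simp
qed auto

lemma four_block_mat_cases:
  assumes "X \<in> carrier_mat (r1 + r2) (c1 + c2)"
  obtains A B C D where "A \<in> carrier_mat r1 c1" "B \<in> carrier_mat r1 c2" "C \<in> carrier_mat r2 c1"
    "D \<in> carrier_mat r2 c2" "X = four_block_mat A B C D"
proof -
  obtain A B C D where "split_block X r1 c1 = (A,B,C,D)" by (metis prod_cases4)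
  note split = split_block[OF this, of r2 c2]
  show ?thesis by (rule that[OF split]) (use assms in auto)
qed

text \<open>The step function of \<^const>\<open>diag_block_mat\<close>: statements about direct sums of lists reduce to
  this two-term sum by induction.\<close>

definition block_sum :: "'a::zero mat \<Rightarrow> 'a mat \<Rightarrow> 'a mat" where
  "block_sum A B =
     four_block_mat A (0\<^sub>m (dim_row A) (dim_col B)) (0\<^sub>m (dim_row B) (dim_col A)) B"

lemma diag_block_mat_Cons: "diag_block_mat (A # As) = block_sum A (diag_block_mat As)"
  by (simp add: block_sum_def Let_def)

lemma block_sum_carrier:
  "A \<in> carrier_mat a a' \<Longrightarrow> B \<in> carrier_mat b b' \<Longrightarrow> block_sum A B \<in> carrier_mat (a + b) (a' + b')"
  by (simp add: block_sum_def)

lemma block_sum_inject: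
  assumes "A \<in> carrier_mat a a'" "A' \<in> carrier_mat a a'" "B \<in> carrier_mat b b'" "B' \<in> carrier_mat b b'"
  shows "block_sum A B = block_sum A' B' \<longleftrightarrow> A = A' \<and> B = B'"
  unfolding block_sum_def
  by (subst four_block_mat_inject[where ?r1.0=a and ?c1.0=a' and ?r2.0=b and ?c2.0=b'])
     (use assms in auto)

lemma block_sum_mult:
  fixes A B :: "'a::semiring_1 mat"
  assumes "A \<in> carrier_mat a a'" "A' \<in> carrier_mat a' a''" "B \<in> carrier_mat b b'" "B' \<in> carrier_mat b' b''"
  shows "block_sum A B * block_sum A' B' = block_sum (A * A') (B * B')"
  unfolding block_sum_def
  by (subst mult_four_block_mat[of _ a a' _ b' _ b _ _ a'' _ b'']) (use assms in auto)

lemma block_sum_transpose: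
  "A \<in> carrier_mat a a' \<Longrightarrow> B \<in> carrier_mat b b' \<Longrightarrow> (block_sum A B)\<^sup>T = block_sum A\<^sup>T B\<^sup>T"
  unfolding block_sum_def
  by (subst transpose_four_block_mat[of _ a a' _ b' _ b]) auto

lemma block_sum_one: "block_sum (1\<^sub>m a) (1\<^sub>m b) = 1\<^sub>m (a + b)"
  by (simp add: block_sum_def)

lemma block_sum_elements:
  assumes "A \<in> carrier_mat a a'" "B \<in> carrier_mat b b'"
  shows "elements_mat (block_sum A B) \<subseteq> \<real> \<longleftrightarrow> elements_mat A \<subseteq> \<real> \<and> elements_mat B \<subseteq> \<real>"
proof -
  have "A $$ (i,j) \<in> \<real>" if "\<forall>i<a+b. \<forall>j<a'+b'. block_sum A B $$ (i,j) \<in> \<real>" "i < a" "j < a'" for i j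
    using that(1)[rule_format, of i j] that(2,3) assms by (simp add: block_sum_def)
  moreover have "B $$ (i,j) \<in> \<real>" if "\<forall>i<a+b. \<forall>j<a'+b'. block_sum A B $$ (i,j) \<in> \<real>" "i < b" "j < b'" for i j
    using that(1)[rule_format, of "i+a" "j+a'"] that(2,3) assms by (simp add: block_sum_def)
  moreover have "block_sum A B $$ (i,j) \<in> \<real>"
    if "\<forall>i<a. \<forall>j<a'. A $$ (i,j) \<in> \<real>" "\<forall>i<b. \<forall>j<b'. B $$ (i,j) \<in> \<real>" "i < a + b" "j < a' + b'" for i j
    using that assms by (simp add: block_sum_def)
  ultimately show ?thesis
    unfolding elements_mat_subset_iff[OF block_sum_carrier[OF assms]]
      elements_mat_subset_iff[OF assms(1)] elements_mat_subset_iff[OF assms(2)] by blast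
qed

lemma block_sum_real_orthogonal:
  assumes A: "A \<in> carrier_mat a a" and B: "B \<in> carrier_mat b b"
  shows "block_sum A B \<in> real_orthogonal (a + b) \<longleftrightarrow> A \<in> real_orthogonal a \<and> B \<in> real_orthogonal b"
proof -
  have t: "A\<^sup>T \<in> carrier_mat a a" "B\<^sup>T \<in> carrier_mat b b" using A B by auto
  have "block_sum A B * (block_sum A B)\<^sup>T = 1\<^sub>m (a + b) \<longleftrightarrow> A * A\<^sup>T = 1\<^sub>m a \<and> B * B\<^sup>T = 1\<^sub>m b"
    unfolding block_sum_transpose[OF A B] block_sum_mult[OF A t(1) B t(2)] block_sum_one[symmetric]
    by (rule block_sum_inject[of _ a a _ _ b b]) (use A B in auto)
  moreover have "(block_sum A B)\<^sup>T * block_sum A B = 1\<^sub>m (a + b) \<longleftrightarrow> A\<^sup>T * A = 1\<^sub>m a \<and> B\<^sup>T * B = 1\<^sub>m b"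
    unfolding block_sum_transpose[OF A B] block_sum_mult[OF t(1) A t(2) B] block_sum_one[symmetric]
    by (rule block_sum_inject[of _ a a _ _ b b]) (use A B in auto)
  ultimately show ?thesis
    using block_sum_carrier[OF A B] block_sum_elements[OF A B] A B
    by (auto simp: real_orthogonal_iff)
qed

section \<open>Real isotropy groups of direct sums\<close>

definition real_isotropy :: "complex mat \<Rightarrow> complex mat set" where
  "real_isotropy K = isotropy (dim_row K) K \<inter> real_orthogonal (dim_row K)"

lemma real_isotropy_iff:
  assumes K: "K \<in> carrier_mat n n"
  shows "X \<in> real_isotropy K \<longleftrightarrow> X \<in> real_orthogonal n \<and> K * X = X * K"
proof (cases "X \<in> real_orthogonal n")
  case True
  then have X: "X \<in> carrier_mat n n" "X * X\<^sup>T = 1\<^sub>m n" "X\<^sup>T * X = 1\<^sub>m n"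
    by (auto simp: real_orthogonal_iff)
  have "X\<^sup>T * K * X = K \<longleftrightarrow> K * X = X * K"
  proof
    assume "X\<^sup>T * K * X = K"
    then have "X * K = X * (X\<^sup>T * K * X)" by simp
    also have "\<dots> = (X * X\<^sup>T) * (K * X)"
      using X(1) K by (simp add: assoc_mult_mat[of _ n n _ n _ n])
    finally show "K * X = X * K" using X K by simp
  next
    assume "K * X = X * K"
    then have "X\<^sup>T * K * X = (X\<^sup>T * X) * K"
      using X(1) K by (simp add: assoc_mult_mat[of _ n n _ n _ n])
    then show "X\<^sup>T * K * X = K" using X K by simp
  qed
  then show ?thesis
    using K True by (auto simp: real_isotropy_def isotropy_def real_orthogonal_def)
qed (use K in \<open>auto simp: real_isotropy_def\<close>)

text \<open>Orthogonality of \<open>X\<close> makes the isotropy condition invariant under transposition. This second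
  commutation relation is what separates the blocks later on.\<close>

lemma real_isotropy_transpose:
  assumes K: "K \<in> carrier_mat n n" and "X \<in> real_isotropy K"
  shows "K\<^sup>T * X = X * K\<^sup>T"
proof -
  have X: "X \<in> carrier_mat n n" "X * X\<^sup>T = 1\<^sub>m n" "X\<^sup>T * K * X = K"
    using assms by (auto simp: real_isotropy_def isotropy_def real_orthogonal_iff)
  have "K\<^sup>T = (X\<^sup>T * K * X)\<^sup>T" using X by simp
  also have "\<dots> = X\<^sup>T * K\<^sup>T * X"
    using X(1) K by (simp add: transpose_mult[of _ n n _ n] assoc_mult_mat[of _ n n _ n _ n])
  finally have "X * K\<^sup>T = X * (X\<^sup>T * K\<^sup>T * X)" by simp
  also have "\<dots> = (X * X\<^sup>T) * (K\<^sup>T * X)"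
    using X(1) K by (simp add: assoc_mult_mat[of _ n n _ n _ n])
  finally show ?thesis using X K by simp
qed

text \<open>Real isotropies commute with both matrix and transpose, so only the common intertwiners of
  \<open>(K, K\<^sup>T)\<close> and \<open>(L, L\<^sup>T)\<close> can occur as off-diagonal blocks.\<close>

definition no_intertwiner :: "complex mat \<Rightarrow> complex mat \<Rightarrow> bool" where
  "no_intertwiner K L \<longleftrightarrow> (\<forall>Y \<in> carrier_mat (dim_row K) (dim_row L).
     K * Y = Y * L \<and> K\<^sup>T * Y = Y * L\<^sup>T \<longrightarrow> Y = 0\<^sub>m (dim_row K) (dim_row L))"

lemma block_sum_commute_iff:
  assumes K: "K \<in> carrier_mat k k" and L: "L \<in> carrier_mat l l"
    and X: "A \<in> carrier_mat k k" "B \<in> carrier_mat k l" "C \<in> carrier_mat l k" "D \<in> carrier_mat l l"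
  shows "block_sum K L * four_block_mat A B C D = four_block_mat A B C D * block_sum K L \<longleftrightarrow>
    K * A = A * K \<and> K * B = B * L \<and> L * C = C * K \<and> L * D = D * L"
proof -
  have 1: "block_sum K L * four_block_mat A B C D = four_block_mat (K * A) (K * B) (L * C) (L * D)"
    unfolding block_sum_def by (subst mult_four_block_mat[of _ k k _ l _ l _ _ k _ l]) (use assms in auto)
  have 2: "four_block_mat A B C D * block_sum K L = four_block_mat (A * K) (B * L) (C * K) (D * L)"
    unfolding block_sum_def by (subst mult_four_block_mat[of _ k k _ l _ l _ _ k _ l]) (use assms in auto)
  show ?thesis unfolding 1 2
    by (rule four_block_mat_inject[of _ k k _ l _ l]) (use assms in auto)
qed

text \<open>Comparing blocks in \<open>(K \<oplus> L) X = X (K \<oplus> L)\<close>, the upper right block of \<open>X\<close> is an intertwiner from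
  \<open>L\<close> to \<open>K\<close>, and the transpose of the lower left block is one too because the pairs \<open>(K, K\<^sup>T)\<close>
  and \<open>(L, L\<^sup>T)\<close> are stable under transposition.\<close>

lemma real_isotropy_block_sum:
  assumes K: "K \<in> carrier_mat k k" and L: "L \<in> carrier_mat l l" and no: "no_intertwiner K L"
  shows "real_isotropy (block_sum K L) =
    {block_sum A B | A B. A \<in> real_isotropy K \<and> B \<in> real_isotropy L}"
proof (intro equalityI subsetI)
  note KL = block_sum_carrier[OF K L]
  have zero: "Y = 0\<^sub>m k l" if "Y \<in> carrier_mat k l" "K * Y = Y * L" "K\<^sup>T * Y = Y * L\<^sup>T" for Y
    using no that K L by (auto simp: no_intertwiner_def)
  fix X assume X: "X \<in> real_isotropy (block_sum K L)"
  then have Xo: "X \<in> real_orthogonal (k + l)"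
    and com: "block_sum K L * X = X * block_sum K L"
    by (auto simp: real_isotropy_iff[OF KL])
  have com': "block_sum K\<^sup>T L\<^sup>T * X = X * block_sum K\<^sup>T L\<^sup>T"
    using real_isotropy_transpose[OF KL X] by (simp add: block_sum_transpose[OF K L])
  from Xo have "X \<in> carrier_mat (k + l) (k + l)" by (simp add: real_orthogonal_iff)
  then obtain A B C D where ABCD: "A \<in> carrier_mat k k" "B \<in> carrier_mat k l" "C \<in> carrier_mat l k"
    "D \<in> carrier_mat l l" and X_eq: "X = four_block_mat A B C D"
    by (rule four_block_mat_cases)
  have KT: "K\<^sup>T \<in> carrier_mat k k" and LT: "L\<^sup>T \<in> carrier_mat l l" using K L by auto
  have c: "K * A = A * K" "K * B = B * L" "L * C = C * K" "L * D = D * L"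
    using com block_sum_commute_iff[OF K L ABCD] by (auto simp: X_eq)
  have c': "K\<^sup>T * B = B * L\<^sup>T" "L\<^sup>T * C = C * K\<^sup>T"
    using com' block_sum_commute_iff[OF KT LT ABCD] by (auto simp: X_eq)
  have B0: "B = 0\<^sub>m k l" using ABCD c c' by (intro zero) auto
  have "C\<^sup>T = 0\<^sub>m k l"
  proof (rule zero)
    have "(L\<^sup>T * C)\<^sup>T = (C * K\<^sup>T)\<^sup>T" using c' by simp
    then show "K * C\<^sup>T = C\<^sup>T * L"
      using ABCD K L by (simp add: transpose_mult[of _ l l _ k] transpose_mult[of _ l k _ k])
    have "(L * C)\<^sup>T = (C * K)\<^sup>T" using c by simp
    then show "K\<^sup>T * C\<^sup>T = C\<^sup>T * L\<^sup>T"
      using ABCD K L by (simp add: transpose_mult[of _ l l _ k] transpose_mult[of _ l k _ k])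
  qed (use ABCD in auto)
  then have C0: "C = 0\<^sub>m l k" by (metis transpose_transpose zero_transpose_mat)
  have X_sum: "X = block_sum A D" using ABCD by (simp add: X_eq B0 C0 block_sum_def)
  then have "A \<in> real_isotropy K" "D \<in> real_isotropy L"
    using Xo block_sum_real_orthogonal[of A k D l] ABCD c
    by (auto simp: real_isotropy_iff[OF K] real_isotropy_iff[OF L])
  with X_sum show "X \<in> {block_sum A B | A B. A \<in> real_isotropy K \<and> B \<in> real_isotropy L}" by auto
next
  fix X assume "X \<in> {block_sum A B | A B. A \<in> real_isotropy K \<and> B \<in> real_isotropy L}"
  then obtain A B where X: "X = block_sum A B" and A: "A \<in> real_isotropy K" and B: "B \<in> real_isotropy L"
    by auto
  have A': "A \<in> real_orthogonal k" "K * A = A * K" "A \<in> carrier_mat k k"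
    and B': "B \<in> real_orthogonal l" "L * B = B * L" "B \<in> carrier_mat l l"
    using A B by (auto simp: real_isotropy_iff[OF K] real_isotropy_iff[OF L] real_orthogonal_iff)
  have "X \<in> real_orthogonal (k + l)"
    unfolding X using A' B' by (simp only: block_sum_real_orthogonal)
  moreover have "block_sum K L * X = X * block_sum K L"
    unfolding X block_sum_mult[OF K A'(3) L B'(3)] block_sum_mult[OF A'(3) K B'(3) L] A'(2) B'(2) ..
  ultimately show "X \<in> real_isotropy (block_sum K L)"
    unfolding real_isotropy_iff[OF block_sum_carrier[OF K L]] by blast
qed

text \<open>An intertwiner into a direct sum consists of a left and a right part, each of which is an
  intertwiner for one summand.\<close>

lemma no_intertwiner_block_sum:
  assumes K: "K \<in> carrier_mat k k" and L: "L \<in> carrier_mat l l" and M: "M \<in> carrier_mat m m"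
    and KL: "no_intertwiner K L" and KM: "no_intertwiner K M"
  shows "no_intertwiner K (block_sum L M)"
  unfolding no_intertwiner_def
proof (intro ballI impI)
  \<comment> \<open>A matrix with \<open>k\<close> rows is treated as a block matrix with an empty second row of blocks.\<close>
  have split: "P * Y1 = Y1 * Q \<and> P * Y2 = Y2 * R"
    if P: "P \<in> carrier_mat k k" and Q: "Q \<in> carrier_mat l l" and R: "R \<in> carrier_mat m m"
      and Y: "Y1 \<in> carrier_mat k l" "Y2 \<in> carrier_mat k m" "Y3 \<in> carrier_mat 0 l" "Y4 \<in> carrier_mat 0 m"
      and eq: "P * four_block_mat Y1 Y2 Y3 Y4 = four_block_mat Y1 Y2 Y3 Y4 * block_sum Q R"
    for P Q R Y1 Y2 Y3 Y4 :: "complex mat"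
  proof -
    have "P = block_sum P (0\<^sub>m 0 0)" using P by (intro eq_matI) (auto simp: block_sum_def)
    then have "P * four_block_mat Y1 Y2 Y3 Y4 = block_sum P (0\<^sub>m 0 0) * four_block_mat Y1 Y2 Y3 Y4" by simp
    also have "\<dots> = four_block_mat (P * Y1) (P * Y2) (0\<^sub>m 0 0 * Y3) (0\<^sub>m 0 0 * Y4)"
      unfolding block_sum_def by (subst mult_four_block_mat[of _ k k _ 0 _ 0 _ _ l _ m]) (use P Y in auto)
    finally have 1: "P * four_block_mat Y1 Y2 Y3 Y4 = four_block_mat (P * Y1) (P * Y2) (0\<^sub>m 0 0 * Y3) (0\<^sub>m 0 0 * Y4)" .
    have 2: "four_block_mat Y1 Y2 Y3 Y4 * block_sum Q R = four_block_mat (Y1 * Q) (Y2 * R) (Y3 * Q) (Y4 * R)"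
      unfolding block_sum_def by (subst mult_four_block_mat[of _ k l _ m _ 0 _ _ l _ m]) (use Q R Y in auto)
    show ?thesis
      using eq unfolding 1 2
      by (subst (asm) four_block_mat_inject[of _ k l _ m _ 0]) (use P Q R Y in auto)
  qed
  fix Y :: "complex mat" assume "Y \<in> carrier_mat (dim_row K) (dim_row (block_sum L M))"
  then have "Y \<in> carrier_mat (k + 0) (l + m)" using K L M by (simp add: block_sum_def)
  then obtain Y1 Y2 Y3 Y4 where Y: "Y1 \<in> carrier_mat k l" "Y2 \<in> carrier_mat k m"
      "Y3 \<in> carrier_mat 0 l" "Y4 \<in> carrier_mat 0 m" and Y_eq: "Y = four_block_mat Y1 Y2 Y3 Y4"
    by (rule four_block_mat_cases)
  assume "K * Y = Y * block_sum L M \<and> K\<^sup>T * Y = Y * (block_sum L M)\<^sup>T"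
  then have "K * Y = Y * block_sum L M" "K\<^sup>T * Y = Y * block_sum L\<^sup>T M\<^sup>T"
    by (auto simp: block_sum_transpose[OF L M])
  from split[OF K L M Y this(1)[unfolded Y_eq]] split[OF _ _ _ Y this(2)[unfolded Y_eq]] K L M
  have "K * Y1 = Y1 * L" "K * Y2 = Y2 * M" "K\<^sup>T * Y1 = Y1 * L\<^sup>T" "K\<^sup>T * Y2 = Y2 * M\<^sup>T"
    by auto
  then have "Y1 = 0\<^sub>m k l" "Y2 = 0\<^sub>m k m"
    using KL KM K L M Y by (auto simp: no_intertwiner_def)
  then have "Y = four_block_mat (0\<^sub>m k l) (0\<^sub>m k m) Y3 Y4" by (simp only: Y_eq)
  also have "\<dots> = 0\<^sub>m k (l + m)" using Y(3,4) by (intro eq_matI) auto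
  finally show "Y = 0\<^sub>m (dim_row K) (dim_row (block_sum L M))"
    using K L M by (simp add: block_sum_def)
qed

lemma set_direct_sum_Nil: "set_direct_sum [] = {0\<^sub>m 0 0}"
  by (simp add: set_direct_sum_def)

lemma set_direct_sum_Cons:
  "set_direct_sum (S # Ss) = {block_sum A B | A B. A \<in> S \<and> B \<in> set_direct_sum Ss}"
proof (intro equalityI subsetI)
  fix X assume "X \<in> set_direct_sum (S # Ss)"
  then obtain A As where "A \<in> S" "As \<in> listset Ss" "X = block_sum A (diag_block_mat As)"
    unfolding set_direct_sum_def listset.simps set_Cons_def by (auto simp only: diag_block_mat_Cons)
  then show "X \<in> {block_sum A B | A B. A \<in> S \<and> B \<in> set_direct_sum Ss}"
    unfolding set_direct_sum_def by blast
next
  fix X assume "X \<in> {block_sum A B | A B. A \<in> S \<and> B \<in> set_direct_sum Ss}"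
  then obtain A As where "A \<in> S" "As \<in> listset Ss" "X = diag_block_mat (A # As)"
    unfolding set_direct_sum_def by (auto simp only: diag_block_mat_Cons)
  then show "X \<in> set_direct_sum (S # Ss)"
    unfolding set_direct_sum_def listset.simps set_Cons_def by blast
qed

lemma diag_block_mat_carrier:
  assumes "\<forall>K\<in>set Ks. square_mat K"
  shows "diag_block_mat Ks \<in> carrier_mat (\<Sum>K\<leftarrow>Ks. dim_row K) (\<Sum>K\<leftarrow>Ks. dim_row K)"
proof -
  have "map dim_col Ks = map dim_row Ks" using assms by auto
  then show ?thesis by (intro carrier_matI) (simp_all only: dim_diag_block_mat)
qed

lemma no_intertwiner_diag_block_mat:
  assumes K: "square_mat K" and "\<forall>L\<in>set Ls. square_mat L \<and> no_intertwiner K L"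
  shows "no_intertwiner K (diag_block_mat Ls)"
  using assms(2)
proof (induction Ls)
  case Nil
  then show ?case by (auto simp: no_intertwiner_def)
next
  case (Cons L Ls)
  show ?case unfolding diag_block_mat_Cons
  proof (rule no_intertwiner_block_sum)
    show "K \<in> carrier_mat (dim_row K) (dim_row K)" "L \<in> carrier_mat (dim_row L) (dim_row L)"
      using K Cons.prems by auto
    show "diag_block_mat Ls \<in> carrier_mat (\<Sum>K\<leftarrow>Ls. dim_row K) (\<Sum>K\<leftarrow>Ls. dim_row K)"
      using Cons.prems by (intro diag_block_mat_carrier) auto
  qed (use Cons in auto)
qed

text \<open>Induction on the list: the first block has no intertwiner with the direct sum of the others, so
  it splits off.\<close>

theorem real_isotropy_diag_block_mat:
  assumes "\<forall>K\<in>set Ks. square_mat K" and "sorted_wrt no_intertwiner Ks"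
  shows "real_isotropy (diag_block_mat Ks) = set_direct_sum (map real_isotropy Ks)"
  using assms
proof (induction Ks)
  case Nil
  have "X = 0\<^sub>m 0 0" if "X \<in> carrier_mat 0 0" for X :: "complex mat"
    using that by (intro eq_matI) auto
  then have "X = 0\<^sub>m 0 0" if "X \<in> real_isotropy (0\<^sub>m 0 0)" for X
    using that unfolding real_isotropy_iff[OF zero_carrier_mat] real_orthogonal_iff by blast
  moreover have "0\<^sub>m 0 0 \<in> real_isotropy (0\<^sub>m 0 0)"
    unfolding real_isotropy_iff[OF zero_carrier_mat] real_orthogonal_iff by (auto simp: elements_mat_def)
  ultimately show ?case by (auto simp: set_direct_sum_Nil)
next
  case (Cons K Ks)
  then have "real_isotropy (diag_block_mat Ks) = set_direct_sum (map real_isotropy Ks)" by simp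
  moreover have "K \<in> carrier_mat (dim_row K) (dim_row K)" "no_intertwiner K (diag_block_mat Ks)"
      "diag_block_mat Ks \<in> carrier_mat (\<Sum>K\<leftarrow>Ks. dim_row K) (\<Sum>K\<leftarrow>Ks. dim_row K)"
    using Cons.prems by (auto intro!: diag_block_mat_carrier no_intertwiner_diag_block_mat)
  ultimately show ?case
    by (simp add: diag_block_mat_Cons real_isotropy_block_sum set_direct_sum_Cons del: diag_block_mat.simps)
qed

section \<open>Conjugation by real orthogonal matrices\<close>

lemma real_orthogonal_mult:
  assumes "P \<in> real_orthogonal n" "Q \<in> real_orthogonal n"
  shows "P * Q \<in> real_orthogonal n"
proof -
  have P: "P \<in> carrier_mat n n" "P * P\<^sup>T = 1\<^sub>m n" "P\<^sup>T * P = 1\<^sub>m n" "\<forall>i<n. \<forall>j<n. P $$ (i,j) \<in> \<real>"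
    and Q: "Q \<in> carrier_mat n n" "Q * Q\<^sup>T = 1\<^sub>m n" "Q\<^sup>T * Q = 1\<^sub>m n" "\<forall>i<n. \<forall>j<n. Q $$ (i,j) \<in> \<real>"
    using assms by (auto simp: real_orthogonal_iff elements_mat_subset_iff)
  have "P * Q * (P * Q)\<^sup>T = P * (Q * Q\<^sup>T) * P\<^sup>T"
    using P(1) Q(1) by (simp add: transpose_mult[of _ n n _ n] assoc_mult_mat[of _ n n _ n _ n])
  moreover have "(P * Q)\<^sup>T * (P * Q) = Q\<^sup>T * (P\<^sup>T * P) * Q"
    using P(1) Q(1) by (simp add: transpose_mult[of _ n n _ n] assoc_mult_mat[of _ n n _ n _ n])
  moreover have "\<forall>i<n. \<forall>j<n. (P * Q) $$ (i,j) \<in> \<real>"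
    using P Q by (auto simp: scalar_prod_def intro!: sum_in_Reals Reals_mult)
  ultimately show ?thesis
    using P Q by (simp add: real_orthogonal_iff elements_mat_subset_iff[of _ n n])
qed

lemma real_orthogonal_transpose: "P \<in> real_orthogonal n \<Longrightarrow> P\<^sup>T \<in> real_orthogonal n"
  by (auto simp: real_orthogonal_iff elements_mat_subset_iff[of _ n n])

text \<open>Stated for any \<open>P\<close> with inverse \<open>R\<close>, so that it serves with \<open>(P, P\<^sup>T)\<close> and with \<open>(P\<^sup>T, P)\<close>.\<close>

lemma conjugate_mult:
  fixes P :: "'a::comm_ring_1 mat"
  assumes "P \<in> carrier_mat n n" "R \<in> carrier_mat n n" "P * R = 1\<^sub>m n"
    and "X \<in> carrier_mat n n" "Y \<in> carrier_mat n n"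
  shows "(R * X * P) * (R * Y * P) = R * (X * Y) * P"
proof -
  have "(R * X * P) * (R * Y * P) = R * X * (P * R) * (Y * P)"
    using assms(1,2,4,5) by (simp add: assoc_mult_mat[of _ n n _ n _ n])
  also have "\<dots> = R * (X * Y) * P"
    unfolding assms(3) using assms(1,2,4,5) by (simp add: assoc_mult_mat[of _ n n _ n _ n])
  finally show ?thesis .
qed

lemma conjugate_inverse:
  fixes P :: "'a::comm_ring_1 mat"
  assumes "P \<in> carrier_mat n n" "R \<in> carrier_mat n n" "R * P = 1\<^sub>m n" and "X \<in> carrier_mat n n"
  shows "R * (P * X * R) * P = X"
proof -
  have "R * (P * X * R) * P = (R * P) * X * (R * P)"
    using assms(1,2,4) by (simp add: assoc_mult_mat[of _ n n _ n _ n])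
  then show ?thesis using assms by simp
qed

lemma real_isotropy_conjugate_subset:
  assumes P: "P \<in> real_orthogonal n" and L: "L \<in> carrier_mat n n" and X: "X \<in> real_isotropy L"
  shows "P\<^sup>T * X * P \<in> real_isotropy (P\<^sup>T * L * P)"
proof -
  have P': "P \<in> carrier_mat n n" "P\<^sup>T \<in> carrier_mat n n" "P * P\<^sup>T = 1\<^sub>m n"
    using P by (auto simp: real_orthogonal_iff)
  have X': "X \<in> carrier_mat n n" "X \<in> real_orthogonal n" "L * X = X * L"
    using X by (auto simp: real_isotropy_iff[OF L] real_orthogonal_iff)
  have K: "P\<^sup>T * L * P \<in> carrier_mat n n" using P' L by simp
  show ?thesis
    unfolding real_isotropy_iff[OF K] conjugate_mult[OF P' L X'(1)] conjugate_mult[OF P' X'(1) L] X'(3)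
    using P X' by (auto intro: real_orthogonal_mult real_orthogonal_transpose)
qed

lemma real_isotropy_conjugate:
  assumes P: "P \<in> real_orthogonal n" and L: "L \<in> carrier_mat n n"
  shows "real_isotropy (P\<^sup>T * L * P) = (\<lambda>X. P\<^sup>T * X * P) ` real_isotropy L"
proof (intro equalityI subsetI)
  have P': "P \<in> carrier_mat n n" "P\<^sup>T \<in> carrier_mat n n" "P * P\<^sup>T = 1\<^sub>m n" "P\<^sup>T * P = 1\<^sub>m n"
    using P by (auto simp: real_orthogonal_iff)
  fix Y assume Y: "Y \<in> real_isotropy (P\<^sup>T * L * P)"
  have K: "P\<^sup>T * L * P \<in> carrier_mat n n" using P' L by simp
  have Y': "Y \<in> carrier_mat n n"
    using Y unfolding real_isotropy_iff[OF K] real_orthogonal_iff by blast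
  have "P * Y * P\<^sup>T \<in> real_isotropy (P * (P\<^sup>T * L * P) * P\<^sup>T)"
    using real_isotropy_conjugate_subset[OF real_orthogonal_transpose[OF P] K Y] by simp
  then have "P * Y * P\<^sup>T \<in> real_isotropy L"
    by (simp only: conjugate_inverse[OF P'(2,1,3) L])
  moreover have "Y = P\<^sup>T * (P * Y * P\<^sup>T) * P"
    by (simp only: conjugate_inverse[OF P'(1,2,4) Y'])
  ultimately show "Y \<in> (\<lambda>X. P\<^sup>T * X * P) ` real_isotropy L" by (rule rev_image_eqI)
qed (use real_isotropy_conjugate_subset[OF P L] in blast)

section \<open>Simultaneous permutation of rows and columns\<close>

text \<open>Similarity by a permutation matrix, expressed entrywise. In this form it is easily combined
  along direct sums; \<open>perm_similarE\<close> recovers the permutation matrix.\<close>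

definition perm_similar :: "complex mat \<Rightarrow> complex mat \<Rightarrow> bool" where
  "perm_similar A B \<longleftrightarrow> (\<exists>n p. p permutes {..<n} \<and> A \<in> carrier_mat n n \<and> B \<in> carrier_mat n n \<and>
     (\<forall>i<n. \<forall>j<n. A $$ (i,j) = B $$ (p i, p j)))"

lemma permutes_lessThanI:
  fixes p :: "nat \<Rightarrow> nat"
  assumes "inj_on p {..<n}" "\<And>i. i < n \<Longrightarrow> p i < n" "\<And>i. n \<le> i \<Longrightarrow> p i = i"
  shows "p permutes {..<n}"
proof (rule bij_imp_permutes)
  have "p ` {..<n} = {..<n}" using assms by (intro endo_inj_surj) auto
  with assms(1) show "bij_betw p {..<n} {..<n}" by (simp add: bij_betw_def)
qed (use assms in auto)

lemma perm_similar_refl: "A \<in> carrier_mat n n \<Longrightarrow> perm_similar A A"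
  unfolding perm_similar_def by (intro exI[of _ n] exI[of _ id]) (simp add: permutes_id)

lemma perm_similar_block_sum:
  assumes "perm_similar A A'" "perm_similar B B'"
  shows "perm_similar (block_sum A B) (block_sum A' B')"
proof -
  obtain a p where p: "p permutes {..<a}" and A: "A \<in> carrier_mat a a" "A' \<in> carrier_mat a a"
    and Ap: "\<And>i j. i < a \<Longrightarrow> j < a \<Longrightarrow> A $$ (i,j) = A' $$ (p i, p j)"
    using assms(1) unfolding perm_similar_def by blast
  obtain b q where q: "q permutes {..<b}" and B: "B \<in> carrier_mat b b" "B' \<in> carrier_mat b b"
    and Bq: "\<And>i j. i < b \<Longrightarrow> j < b \<Longrightarrow> B $$ (i,j) = B' $$ (q i, q j)"
    using assms(2) unfolding perm_similar_def by blast
  have p_less: "p i < a \<longleftrightarrow> i < a" for i using permutes_in_image[OF p, of i] by simp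
  have q_less: "q i < b \<longleftrightarrow> i < b" for i using permutes_in_image[OF q, of i] by simp
  define r where "r i = (if i < a then p i else a + q (i - a))" for i
  have "r permutes {..<a + b}"
  proof (rule permutes_lessThanI)
    show "inj_on r {..<a + b}"
    proof (rule inj_onI)
      fix i j assume "r i = r j"
      then show "i = j"
        using p_less[of i] p_less[of j] permutes_inj[OF p] permutes_inj[OF q]
        by (auto simp: r_def inj_eq split: if_splits)
    qed
    show "r i < a + b" if "i < a + b" for i
      using that p_less[of i] q_less[of "i - a"] by (auto simp: r_def)
    show "r i = i" if "a + b \<le> i" for i
      using that permutes_not_in[OF q, of "i - a"] by (auto simp: r_def)
  qed
  moreover have "block_sum A B $$ (i,j) = block_sum A' B' $$ (r i, r j)" if "i < a + b" "j < a + b" for i j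
    using that A B p_less[of i] p_less[of j] q_less[of "i - a"] q_less[of "j - a"] Ap[of i j] Bq[of "i - a" "j - a"]
    by (auto simp: r_def block_sum_def)
  ultimately show ?thesis
    using block_sum_carrier[OF A(1) B(1)] block_sum_carrier[OF A(2) B(2)]
    unfolding perm_similar_def by blast
qed

lemma perm_similar_diag_block_mat:
  assumes "list_all2 perm_similar Ks Ls"
  shows "perm_similar (diag_block_mat Ks) (diag_block_mat Ls)"
  using assms
proof (induction rule: list_all2_induct)
  case Nil
  show ?case by (auto intro: perm_similar_refl[of _ 0])
next
  case (Cons K Ks L Ls)
  then show ?case by (simp only: diag_block_mat_Cons perm_similar_block_sum)
qed

text \<open>The permutation matrix with columns \<open>e\<^bsub>p j\<^esub>\<close> is real orthogonal, and multiplying by it on the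
  right, or by its transpose on the left, replaces column \<open>j\<close> by column \<open>p j\<close>, or row \<open>i\<close> by row
  \<open>p i\<close>.\<close>

lemma perm_similarE:
  assumes "perm_similar K L"
  obtains n P where "K \<in> carrier_mat n n" "L \<in> carrier_mat n n" "permutation_matrix n P"
    "P \<in> real_orthogonal n" "K = P\<^sup>T * L * P"
proof -
  obtain n p where p: "p permutes {..<n}" and K: "K \<in> carrier_mat n n" and L: "L \<in> carrier_mat n n"
    and Kp: "\<And>i j. i < n \<Longrightarrow> j < n \<Longrightarrow> K $$ (i,j) = L $$ (p i, p j)"
    using assms unfolding perm_similar_def by blast
  have p_less: "p i < n \<longleftrightarrow> i < n" for i using permutes_in_image[OF p, of i] by simp
  define P :: "complex mat" where "P = mat n n (\<lambda>(i,j). if i = p j then 1 else 0)"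
  have P: "P \<in> carrier_mat n n" by (simp add: P_def)
  have right: "(X * P) $$ (i,j) = X $$ (i, p j)" if "X \<in> carrier_mat n n" "i < n" "j < n" for X i j
  proof -
    have "(X * P) $$ (i,j) = (\<Sum>k<n. X $$ (i,k) * P $$ (k,j))"
      using that P by (simp add: scalar_prod_def atLeast0LessThan)
    also have "\<dots> = (\<Sum>k<n. if k = p j then X $$ (i,k) else 0)"
      using that by (intro sum.cong) (auto simp: P_def)
    finally show ?thesis using that p_less[of j] by simp
  qed
  have left: "(P\<^sup>T * X) $$ (i,j) = X $$ (p i, j)" if "X \<in> carrier_mat n n" "i < n" "j < n" for X i j
  proof -
    have "(P\<^sup>T * X) $$ (i,j) = (\<Sum>k<n. P $$ (k,i) * X $$ (k,j))"
      using that P by (simp add: scalar_prod_def atLeast0LessThan)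
    also have "\<dots> = (\<Sum>k<n. if k = p i then X $$ (k,j) else 0)"
      using that by (intro sum.cong) (auto simp: P_def)
    finally show ?thesis using that p_less[of i] by simp
  qed
  have "P\<^sup>T * P = 1\<^sub>m n"
  proof (rule eq_matI)
    show "(P\<^sup>T * P) $$ (i,j) = 1\<^sub>m n $$ (i,j)" if "i < dim_row (1\<^sub>m n :: complex mat)" "j < dim_col (1\<^sub>m n :: complex mat)" for i j
    proof -
      from that have ij: "i < n" "j < n" by auto
      have "(P\<^sup>T * P) $$ (i,j) = P $$ (p i, j)" by (rule left[OF P ij])
      also have "\<dots> = (if p i = p j then 1 else 0)" using ij p_less[of i] by (simp add: P_def)
      also have "\<dots> = 1\<^sub>m n $$ (i,j)" using ij by (simp add: inj_eq[OF permutes_inj[OF p]])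
      finally show ?thesis .
    qed
  qed (use P in auto)
  moreover from this have "P * P\<^sup>T = 1\<^sub>m n"
    using P by (intro mat_mult_left_right_inverse[of "P\<^sup>T" n P]) auto
  moreover have "elements_mat P \<subseteq> \<real>"
    unfolding elements_mat_subset_iff[OF P] by (auto simp: P_def)
  ultimately have "P \<in> real_orthogonal n" using P by (simp add: real_orthogonal_iff)
  moreover have "permutation_matrix n P" using p by (auto simp: permutation_matrix_def P_def)
  moreover have "K = P\<^sup>T * L * P"
  proof (rule eq_matI)
    have PL: "P\<^sup>T * L \<in> carrier_mat n n" using P L by simp
    fix i j assume "i < dim_row (P\<^sup>T * L * P)" "j < dim_col (P\<^sup>T * L * P)"
    then have "i < n" "j < n" using P by auto
    then show "K $$ (i,j) = (P\<^sup>T * L * P) $$ (i,j)"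
      using L by (simp only: right[OF PL] left p_less Kp)
  qed (use P K in auto)
  ultimately show ?thesis using K L that by blast
qed

section \<open>Multiplicative bijections between sets of matrices\<close>

text \<open>Isomorphism of two \<^const>\<open>matrix_group\<close>s, phrased for bare sets of matrices so that it passes through
  direct sums without keeping track of sizes.\<close>

definition mult_iso :: "complex mat set \<Rightarrow> complex mat set \<Rightarrow> bool" where
  "mult_iso S T \<longleftrightarrow> (\<exists>f. bij_betw f S T \<and> (\<forall>x\<in>S. \<forall>y\<in>S. f (x * y) = f x * f y))"

lemma matrix_group_iso_iff: "matrix_group n S \<cong> matrix_group k T \<longleftrightarrow> mult_iso S T"
  unfolding is_iso_def iso_def hom_def matrix_group_def mult_iso_def
  by (auto dest: bij_betwE)

lemma mult_iso_refl: "mult_iso S S"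
  unfolding mult_iso_def by (intro exI[of _ id]) auto

lemma mult_iso_trans:
  assumes "mult_iso S T" "mult_iso T U"
  shows "mult_iso S U"
proof -
  obtain f g where f: "bij_betw f S T" "\<And>x y. x \<in> S \<Longrightarrow> y \<in> S \<Longrightarrow> f (x * y) = f x * f y"
    and g: "bij_betw g T U" "\<And>x y. x \<in> T \<Longrightarrow> y \<in> T \<Longrightarrow> g (x * y) = g x * g y"
    using assms unfolding mult_iso_def by blast
  show ?thesis unfolding mult_iso_def
    using f g bij_betw_trans[OF f(1) g(1)] bij_betwE[OF f(1)] by (intro exI[of _ "g \<circ> f"]) auto
qed

text \<open>The isomorphism acts on the two diagonal blocks separately; multiplicativity is the block formula
  for products of direct sums.\<close>

lemma mult_iso_block_sum:
  assumes S: "S \<subseteq> carrier_mat s s" "S' \<subseteq> carrier_mat s' s'"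
    and T: "T \<subseteq> carrier_mat t t" "T' \<subseteq> carrier_mat t' t'"
    and "mult_iso S T" "mult_iso S' T'"
  shows "mult_iso {block_sum A B | A B. A \<in> S \<and> B \<in> S'} {block_sum A B | A B. A \<in> T \<and> B \<in> T'}"
    (is "mult_iso ?S ?T")
proof -
  obtain f g where f: "bij_betw f S T" "\<And>x y. x \<in> S \<Longrightarrow> y \<in> S \<Longrightarrow> f (x * y) = f x * f y"
    and g: "bij_betw g S' T'" "\<And>x y. x \<in> S' \<Longrightarrow> y \<in> S' \<Longrightarrow> g (x * y) = g x * g y"
    using assms(5,6) unfolding mult_iso_def by blast
  define F where "F X = (case split_block X s s of (A, _, _, B) \<Rightarrow> block_sum (f A) (g B))" for X
  have F: "F (block_sum A B) = block_sum (f A) (g B)" if "A \<in> carrier_mat s s" "B \<in> carrier_mat s' s'" for A B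
  proof -
    obtain A1 B1 C1 D1 where sp: "split_block (block_sum A B) s s = (A1, B1, C1, D1)" by (metis prod_cases4)
    have "dim_row (block_sum A B) = s + s'" "dim_col (block_sum A B) = s + s'"
      using block_sum_carrier[OF that] by auto
    note spl = split_block[OF sp this]
    have "A = A1 \<and> B = D1"
      using spl(5)[unfolded block_sum_def] that
      by (subst (asm) four_block_mat_inject[OF _ _ _ _ spl(1-4)]) auto
    then show ?thesis unfolding F_def sp prod.case by simp
  qed
  have mem: "f A \<in> T" "g B \<in> T'" if "A \<in> S" "B \<in> S'" for A B
    using that bij_betwE[OF f(1)] bij_betwE[OF g(1)] by auto
  have FS: "F (block_sum A B) = block_sum (f A) (g B)" if "A \<in> S" "B \<in> S'" for A B
    using F S that by blast
  have "inj_on F ?S"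
  proof (rule inj_onI, clarify)
    fix A B A' B' assume m: "A \<in> S" "B \<in> S'" "A' \<in> S" "B' \<in> S'"
      and eq: "F (block_sum A B) = F (block_sum A' B')"
    have "block_sum (f A) (g B) = block_sum (f A') (g B')" using eq m by (simp only: FS)
    moreover have "f A \<in> carrier_mat t t" "f A' \<in> carrier_mat t t" "g B \<in> carrier_mat t' t'" "g B' \<in> carrier_mat t' t'"
      using mem[OF m(1,2)] mem[OF m(3,4)] T by auto
    ultimately have "f A = f A'" "g B = g B'" by (auto simp: block_sum_inject)
    then show "block_sum A B = block_sum A' B'"
      using m bij_betw_imp_inj_on[OF f(1)] bij_betw_imp_inj_on[OF g(1)] by (auto dest: inj_onD)
  qed
  moreover have "F ` ?S = ?T"
  proof (intro equalityI subsetI)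
    fix Z assume "Z \<in> F ` ?S"
    then obtain A B where m: "A \<in> S" "B \<in> S'" and "Z = F (block_sum A B)" by blast
    then have "Z = block_sum (f A) (g B)" by (simp only: FS)
    with mem[OF m] show "Z \<in> ?T" by blast
  next
    fix Z assume "Z \<in> ?T"
    then obtain C D where "Z = block_sum C D" "C \<in> T" "D \<in> T'" by blast
    moreover obtain A B where "A \<in> S" "B \<in> S'" "C = f A" "D = g B"
      using \<open>C \<in> T\<close> \<open>D \<in> T'\<close> bij_betw_imp_surj_on[OF f(1)] bij_betw_imp_surj_on[OF g(1)] by blast
    ultimately have "Z = F (block_sum A B)" "block_sum A B \<in> ?S" by (auto simp only: FS)
    then show "Z \<in> F ` ?S" by blast
  qed
  moreover have "F (X * Y) = F X * F Y" if XY: "X \<in> ?S" "Y \<in> ?S" for X Y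
  proof -
    obtain A B A' B' where X: "X = block_sum A B" "A \<in> S" "B \<in> S'"
      and Y: "Y = block_sum A' B'" "A' \<in> S" "B' \<in> S'"
      using XY by blast
    have c: "A \<in> carrier_mat s s" "A' \<in> carrier_mat s s" "B \<in> carrier_mat s' s'" "B' \<in> carrier_mat s' s'"
      using X Y S by auto
    have d: "f A \<in> carrier_mat t t" "f A' \<in> carrier_mat t t" "g B \<in> carrier_mat t' t'" "g B' \<in> carrier_mat t' t'"
      using mem[OF X(2,3)] mem[OF Y(2,3)] T by auto
    have "F (X * Y) = F (block_sum (A * A') (B * B'))"
      unfolding X(1) Y(1) by (simp only: block_sum_mult[OF c])
    also have "\<dots> = block_sum (f A * f A') (g B * g B')"
      using c X Y by (simp add: F f(2) g(2))
    also have "\<dots> = F X * F Y"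
      using X Y by (simp only: FS block_sum_mult[OF d])
    finally show ?thesis .
  qed
  ultimately show ?thesis unfolding mult_iso_def bij_betw_def by blast
qed

lemma mult_iso_set_direct_sum:
  assumes "list_all2 (\<lambda>S T. mult_iso S T \<and> (\<exists>s. S \<subseteq> carrier_mat s s) \<and> (\<exists>t. T \<subseteq> carrier_mat t t)) Ss Ts"
  shows "mult_iso (set_direct_sum Ss) (set_direct_sum Ts) \<and>
    (\<exists>s. set_direct_sum Ss \<subseteq> carrier_mat s s) \<and> (\<exists>t. set_direct_sum Ts \<subseteq> carrier_mat t t)"
  using assms
proof (induction rule: list_all2_induct)
  case Nil
  show ?case by (auto simp: set_direct_sum_Nil mult_iso_refl intro: exI[of _ 0])
next
  case (Cons S Ss T Ts)
  then obtain s s' t t' where c: "S \<subseteq> carrier_mat s s" "set_direct_sum Ss \<subseteq> carrier_mat s' s'"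
    "T \<subseteq> carrier_mat t t" "set_direct_sum Ts \<subseteq> carrier_mat t' t'" by blast
  have "set_direct_sum (S # Ss) \<subseteq> carrier_mat (s + s') (s + s')"
    unfolding set_direct_sum_Cons using c by (auto intro!: block_sum_carrier)
  moreover have "set_direct_sum (T # Ts) \<subseteq> carrier_mat (t + t') (t + t')"
    unfolding set_direct_sum_Cons using c by (auto intro!: block_sum_carrier)
  moreover have "mult_iso (set_direct_sum (S # Ss)) (set_direct_sum (T # Ts))"
    unfolding set_direct_sum_Cons using Cons by (intro mult_iso_block_sum[OF c(1,2,3,4)]) simp_all
  ultimately show ?case by (intro conjI exI)
qed

text \<open>Conjugation by the permutation matrix maps one isotropy group onto the other and is
  multiplicative.\<close>

lemma permutation_conjugate_real_isotropy:
  assumes "perm_similar K L" and n: "dim_row K = n"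
  shows "permutation_conjugate n (real_isotropy K) (real_isotropy L)"
    and "mult_iso (real_isotropy K) (real_isotropy L)"
    and "real_isotropy L \<subseteq> real_matrices n"
proof -
  obtain n' P where "K \<in> carrier_mat n' n'" and L: "L \<in> carrier_mat n' n'"
    and perm: "permutation_matrix n' P" and P: "P \<in> real_orthogonal n'" and K_eq: "K = P\<^sup>T * L * P"
    using perm_similarE[OF assms(1)] by blast
  from \<open>K \<in> carrier_mat n' n'\<close> n have n': "n' = n" by simp
  note L = L[unfolded n'] and P = P[unfolded n'] and perm = perm[unfolded n']
  have P': "P \<in> carrier_mat n n" "P\<^sup>T \<in> carrier_mat n n" "P * P\<^sup>T = 1\<^sub>m n" "P\<^sup>T * P = 1\<^sub>m n"
    using P by (auto simp: real_orthogonal_iff)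
  have iso: "real_isotropy K = (\<lambda>X. P\<^sup>T * X * P) ` real_isotropy L"
    unfolding K_eq by (rule real_isotropy_conjugate[OF P L])
  then show "permutation_conjugate n (real_isotropy K) (real_isotropy L)"
    unfolding permutation_conjugate_def using perm P'
    by (intro exI[of _ P] exI[of _ "P\<^sup>T"]) (simp add: inverts_mat_def)
  have carrier: "X \<in> carrier_mat n n" if "X \<in> real_isotropy L" for X
    using that by (auto simp: real_isotropy_iff[OF L] real_orthogonal_iff)
  show "real_isotropy L \<subseteq> real_matrices n"
    by (auto simp: real_isotropy_iff[OF L] real_orthogonal_def)
  define f where "f Y = P * Y * P\<^sup>T" for Y
  have inv: "f (P\<^sup>T * X * P) = X" if "X \<in> real_isotropy L" for X
    unfolding f_def by (rule conjugate_inverse[OF P'(2,1,3) carrier[OF that]])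
  have "bij_betw f (real_isotropy K) (real_isotropy L)"
    unfolding iso by (rule bij_betw_byWitness[of _ "\<lambda>X. P\<^sup>T * X * P"]) (auto simp: inv)
  moreover have "f (X * Y) = f X * f Y" if "X \<in> real_isotropy K" "Y \<in> real_isotropy K" for X Y
  proof -
    have "X \<in> carrier_mat n n" "Y \<in> carrier_mat n n"
      using that P' carrier unfolding iso by auto
    then show ?thesis
      unfolding f_def by (rule conjugate_mult[OF P'(2,1,4), symmetric])
  qed
  ultimately show "mult_iso (real_isotropy K) (real_isotropy L)" unfolding mult_iso_def by blast
qed

section \<open>Complex matrices as real matrices of twice the size\<close>

lemma scalar_mat_mult:
  fixes Y :: "'a::comm_semiring_1 mat"
  assumes "Y \<in> carrier_mat r c"
  shows "(t \<cdot>\<^sub>m 1\<^sub>m r) * Y = t \<cdot>\<^sub>m Y" "Y * (t \<cdot>\<^sub>m 1\<^sub>m c) = t \<cdot>\<^sub>m Y"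
  using assms by (simp_all add: mult_smult_assoc_mat[of _ r r _ c] mult_smult_distrib[of _ r c _ c])

text \<open>The map \<open>\<rho>\<close>. It is an injective ring homomorphism that takes adjoints to transposes; the lemmas
  below verify this.\<close>

definition realify :: "complex mat \<Rightarrow> complex mat" where
  "realify Q = four_block_mat (Re_mat Q) (Im_mat Q) (- Im_mat Q) (Re_mat Q)"

lemma realified_unitary_eq: "realified_unitary m = realify ` unitary_matrices m"
  by (auto simp: realified_unitary_def realify_def)

lemma Re_Im_mat_carrier [simp]:
  "Q \<in> carrier_mat r c \<Longrightarrow> Re_mat Q \<in> carrier_mat r c"
  "Q \<in> carrier_mat r c \<Longrightarrow> Im_mat Q \<in> carrier_mat r c"
  by (simp_all add: Re_mat_def Im_mat_def)

lemma realify_carrier: "Q \<in> carrier_mat r c \<Longrightarrow> realify Q \<in> carrier_mat (2 * r) (2 * c)"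
  by (simp add: realify_def mult_2)

lemma Re_Im_mat_decomposition: "Re_mat Q + \<i> \<cdot>\<^sub>m Im_mat Q = Q"
  by (intro eq_matI) (auto simp: Re_mat_def Im_mat_def complex_eq_iff)

lemma realify_inject:
  assumes P: "P \<in> carrier_mat r c" and Q: "Q \<in> carrier_mat r c"
  shows "realify P = realify Q \<longleftrightarrow> P = Q"
proof
  assume "realify P = realify Q"
  then have "Re_mat P = Re_mat Q" "Im_mat P = Im_mat Q"
    unfolding realify_def using P Q
    by (subst (asm) four_block_mat_inject[of _ r c _ c _ r]; simp)+
  then show "P = Q" by (metis Re_Im_mat_decomposition)
qed simp

lemma Re_mat_mult:
  assumes "P \<in> carrier_mat r k" "Q \<in> carrier_mat k c"
  shows "Re_mat (P * Q) = Re_mat P * Re_mat Q + Im_mat P * (- Im_mat Q)"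
  using assms
  by (intro eq_matI) (auto simp: Re_mat_def Im_mat_def scalar_prod_def sum_subtractf sum_negf)

lemma Im_mat_mult:
  assumes "P \<in> carrier_mat r k" "Q \<in> carrier_mat k c"
  shows "Im_mat (P * Q) = Re_mat P * Im_mat Q + Im_mat P * Re_mat Q"
  using assms
  by (intro eq_matI) (auto simp: Re_mat_def Im_mat_def scalar_prod_def sum.distrib)

lemma realify_mult:
  assumes P: "P \<in> carrier_mat r k" and Q: "Q \<in> carrier_mat k c"
  shows "realify (P * Q) = realify P * realify Q"
proof -
  have 1: "realify P * realify Q = four_block_mat
      (Re_mat P * Re_mat Q + Im_mat P * (- Im_mat Q)) (Re_mat P * Im_mat Q + Im_mat P * Re_mat Q)
      (- Im_mat P * Re_mat Q + Re_mat P * (- Im_mat Q)) (- Im_mat P * Im_mat Q + Re_mat P * Re_mat Q)"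
    unfolding realify_def
    by (rule mult_four_block_mat[of _ r k _ k _ r _ _ c _ c]) (use P Q in auto)
  have 2: "- Im_mat P * Re_mat Q + Re_mat P * (- Im_mat Q) = - Im_mat (P * Q)"
    "- Im_mat P * Im_mat Q + Re_mat P * Re_mat Q = Re_mat (P * Q)"
    using P Q
    by (auto intro!: eq_matI simp: Re_mat_def Im_mat_def scalar_prod_def sum.distrib sum_subtractf sum_negf)
  show ?thesis
    unfolding 1 2 Re_mat_mult[OF P Q, symmetric] Im_mat_mult[OF P Q, symmetric]
    by (rule realify_def)
qed

lemma realify_add:
  assumes "P \<in> carrier_mat r c" "Q \<in> carrier_mat r c"
  shows "realify (P + Q) = realify P + realify Q"
  using assms by (intro eq_matI) (auto simp: realify_def Re_mat_def Im_mat_def)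

lemma realify_real_scalar: "realify (of_real t \<cdot>\<^sub>m 1\<^sub>m m) = of_real t \<cdot>\<^sub>m 1\<^sub>m (2 * m)"
  by (intro eq_matI) (auto simp: realify_def Re_mat_def Im_mat_def)

lemma realify_one: "realify (1\<^sub>m m) = 1\<^sub>m (2 * m)"
proof -
  have "of_real 1 \<cdot>\<^sub>m 1\<^sub>m n = (1\<^sub>m n :: complex mat)" for n by (intro eq_matI) auto
  then show ?thesis using realify_real_scalar[of 1 m] by simp
qed

lemma adjoint_carrier: "Q \<in> carrier_mat r c \<Longrightarrow> mat_adjoint Q \<in> carrier_mat c r"
  by (auto simp: mat_adjoint_def mat_of_rows_def)

lemma adjoint_index:
  "Q \<in> carrier_mat r c \<Longrightarrow> i < c \<Longrightarrow> j < r \<Longrightarrow> mat_adjoint Q $$ (i,j) = cnj (Q $$ (j,i))"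
  by (auto simp: mat_adjoint_def mat_of_rows_def)

lemma realify_adjoint:
  fixes Q :: "complex mat"
  assumes Q: "Q \<in> carrier_mat r c"
  shows "realify (mat_adjoint Q) = (realify Q)\<^sup>T"
  using Q adjoint_carrier[OF Q] adjoint_index[OF Q]
  by (intro eq_matI) (auto simp: realify_def Re_mat_def Im_mat_def)

lemma realify_elements:
  assumes "Q \<in> carrier_mat r c"
  shows "elements_mat (realify Q) \<subseteq> \<real>"
  unfolding elements_mat_subset_iff[OF realify_carrier[OF assms]]
  using assms by (auto simp: realify_def Re_mat_def Im_mat_def)

text \<open>Applying \<open>\<rho>\<close> to \<open>Q Q\<^sup>* = I\<close> and \<open>Q\<^sup>* Q = I\<close> gives the orthogonality relations of \<open>\<rho>(Q)\<close>, and
  injectivity allows to go back.\<close>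

lemma realify_real_orthogonal_iff:
  assumes Q: "Q \<in> carrier_mat m m"
  shows "realify Q \<in> real_orthogonal (2 * m) \<longleftrightarrow> Q \<in> unitary_matrices m"
proof -
  note A = adjoint_carrier[OF Q]
  have "realify Q * (realify Q)\<^sup>T = 1\<^sub>m (2 * m) \<longleftrightarrow> Q * mat_adjoint Q = 1\<^sub>m m"
    unfolding realify_adjoint[OF Q, symmetric] realify_one[symmetric] realify_mult[OF Q A, symmetric]
    by (rule realify_inject[of _ m m]) (use Q A in auto)
  moreover have "(realify Q)\<^sup>T * realify Q = 1\<^sub>m (2 * m) \<longleftrightarrow> mat_adjoint Q * Q = 1\<^sub>m m"
    unfolding realify_adjoint[OF Q, symmetric] realify_one[symmetric] realify_mult[OF A Q, symmetric]
    by (rule realify_inject[of _ m m]) (use Q A in auto)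
  ultimately show ?thesis
    using realify_carrier[OF Q] realify_elements[OF Q] Q A
    by (auto simp: real_orthogonal_iff unitary_matrices_def inverts_mat_def)
qed

text \<open>The isomorphism is the inverse of \<open>\<rho>\<close>. It is multiplicative because \<open>\<rho>\<close> is and because unitary
  matrices are closed under products, which is inherited from the orthogonal matrices via \<open>\<rho>\<close>.\<close>

lemma mult_iso_realified_unitary: "mult_iso (realified_unitary m) (unitary_matrices m)"
proof -
  have carrier: "Q \<in> carrier_mat m m" if "Q \<in> unitary_matrices m" for Q
    using that by (simp add: unitary_matrices_def)
  have closed: "P * Q \<in> unitary_matrices m" if "P \<in> unitary_matrices m" "Q \<in> unitary_matrices m" for P Q
  proof -
    have PQ: "P \<in> carrier_mat m m" "Q \<in> carrier_mat m m" "P * Q \<in> carrier_mat m m"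
      using that carrier by (auto intro: mult_carrier_mat)
    have "realify P * realify Q \<in> real_orthogonal (2 * m)"
      using that PQ by (intro real_orthogonal_mult) (auto simp: realify_real_orthogonal_iff)
    then have "realify (P * Q) \<in> real_orthogonal (2 * m)"
      by (simp only: realify_mult[OF PQ(1,2)])
    then show ?thesis by (simp only: realify_real_orthogonal_iff[OF PQ(3)])
  qed
  have inj: "inj_on realify (unitary_matrices m)"
    using carrier by (auto intro!: inj_onI simp: realify_inject[of _ m m])
  define f where "f = the_inv_into (unitary_matrices m) realify"
  have f: "f (realify Q) = Q" if "Q \<in> unitary_matrices m" for Q
    unfolding f_def using inj that by (rule the_inv_into_f_f)
  have "bij_betw f (realified_unitary m) (unitary_matrices m)"
    unfolding f_def realified_unitary_eq using inj
    by (intro bij_betw_the_inv_into) (simp add: bij_betw_def)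
  moreover have "f (X * Y) = f X * f Y" if XY: "X \<in> realified_unitary m" "Y \<in> realified_unitary m" for X Y
  proof -
    obtain P Q where "X = realify P" "Y = realify Q" "P \<in> unitary_matrices m" "Q \<in> unitary_matrices m"
      using XY unfolding realified_unitary_eq by blast
    moreover from this have "X * Y = realify (P * Q)"
      using carrier by (simp add: realify_mult[of _ m m _ m])
    ultimately show ?thesis by (simp add: f closed)
  qed
  ultimately show ?thesis unfolding mult_iso_def by blast
qed

lemma unitary_matrices_carrier: "unitary_matrices m \<subseteq> carrier_mat m m"
  by (auto simp: unitary_matrices_def)

lemma realified_unitary_carrier: "realified_unitary m \<subseteq> carrier_mat (2 * m) (2 * m)"
  using unitary_matrices_carrier by (auto simp: realified_unitary_eq intro!: realify_carrier)

lemma realify_scalar_eq: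
  "realify (z \<cdot>\<^sub>m 1\<^sub>m m) = four_block_mat (of_real (Re z) \<cdot>\<^sub>m 1\<^sub>m m) (of_real (Im z) \<cdot>\<^sub>m 1\<^sub>m m)
     (of_real (- Im z) \<cdot>\<^sub>m 1\<^sub>m m) (of_real (Re z) \<cdot>\<^sub>m 1\<^sub>m m)"
  by (intro eq_matI) (auto simp: realify_def Re_mat_def Im_mat_def)

section \<open>Isotropy groups of the individual blocks\<close>

text \<open>Let \<open>X\<close> have blocks \<open>A, B, C, D\<close>. In the upper two blocks of the commutation relation the terms
  with \<open>Re z\<close> cancel and \<open>Im z \<noteq> 0\<close> can be divided out, leaving \<open>C = - B\<close> and \<open>D = A\<close>. Hence
  \<open>X = \<rho>(A + \<i> B)\<close>, where \<open>A\<close> and \<open>B\<close> are real. Conversely \<open>z I\<close> commutes with every \<open>Q\<close>.\<close>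

lemma real_isotropy_realify_scalar:
  assumes z: "Im z \<noteq> 0"
  shows "real_isotropy (realify (z \<cdot>\<^sub>m 1\<^sub>m m)) = realified_unitary m"
proof (intro equalityI subsetI)
  let ?K = "realify (z \<cdot>\<^sub>m 1\<^sub>m m)"
  have K: "?K \<in> carrier_mat (2 * m) (2 * m)" by (simp add: realify_carrier)
  fix X assume "X \<in> real_isotropy ?K"
  then have Xo: "X \<in> real_orthogonal (2 * m)" and com: "?K * X = X * ?K"
    by (auto simp: real_isotropy_iff[OF K])
  from Xo have "X \<in> carrier_mat (m + m) (m + m)" by (simp add: real_orthogonal_iff mult_2)
  then obtain A B C D where ABCD: "A \<in> carrier_mat m m" "B \<in> carrier_mat m m" "C \<in> carrier_mat m m"
    "D \<in> carrier_mat m m" and X: "X = four_block_mat A B C D"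
    by (rule four_block_mat_cases)
  let ?a = "of_real (Re z) :: complex" and ?b = "of_real (Im z) :: complex"
  note scalar = scalar_mat_mult[where 'a = complex and r = m and c = m]
  have 1: "?K * X = four_block_mat (?a \<cdot>\<^sub>m A + ?b \<cdot>\<^sub>m C) (?a \<cdot>\<^sub>m B + ?b \<cdot>\<^sub>m D)
      (of_real (- Im z) \<cdot>\<^sub>m A + ?a \<cdot>\<^sub>m C) (of_real (- Im z) \<cdot>\<^sub>m B + ?a \<cdot>\<^sub>m D)"
    unfolding X realify_scalar_eq
    by (subst mult_four_block_mat[of _ m m _ m _ m _ _ m _ m]) (use ABCD scalar in auto)
  have 2: "X * ?K = four_block_mat (?a \<cdot>\<^sub>m A + of_real (- Im z) \<cdot>\<^sub>m B) (?b \<cdot>\<^sub>m A + ?a \<cdot>\<^sub>m B)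
      (?a \<cdot>\<^sub>m C + of_real (- Im z) \<cdot>\<^sub>m D) (?b \<cdot>\<^sub>m C + ?a \<cdot>\<^sub>m D)"
    unfolding X realify_scalar_eq
    by (subst mult_four_block_mat[of _ m m _ m _ m _ _ m _ m]) (use ABCD scalar in auto)
  have eqs: "?a \<cdot>\<^sub>m A + ?b \<cdot>\<^sub>m C = ?a \<cdot>\<^sub>m A + of_real (- Im z) \<cdot>\<^sub>m B"
    "?a \<cdot>\<^sub>m B + ?b \<cdot>\<^sub>m D = ?b \<cdot>\<^sub>m A + ?a \<cdot>\<^sub>m B"
    using com unfolding 1 2
    by (subst (asm) four_block_mat_inject[of _ m m _ m _ m]; use ABCD in auto)+
  have C: "C $$ (i,j) = - B $$ (i,j)" and D: "D $$ (i,j) = A $$ (i,j)" if "i < m" "j < m" for i j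
    using arg_cong[OF eqs(1), of "\<lambda>Y. Y $$ (i,j)"] arg_cong[OF eqs(2), of "\<lambda>Y. Y $$ (i,j)"] that ABCD z
    by (auto simp flip: mult_minus_right)
  define Q where "Q = A + \<i> \<cdot>\<^sub>m B"
  have Q: "Q \<in> carrier_mat m m" using ABCD by (simp add: Q_def)
  have real: "X $$ (i,j) \<in> \<real>" if "i < 2 * m" "j < 2 * m" for i j
    using Xo that elements_mat_subset_iff[of X "2 * m" "2 * m" \<real>] by (auto simp: real_orthogonal_iff)
  have A_real: "A $$ (i,j) \<in> \<real>" and B_real: "B $$ (i,j) \<in> \<real>" if "i < m" "j < m" for i j
    using real[of i j] real[of i "j + m"] that ABCD by (auto simp: X)
  have "Re_mat Q = A"
    using ABCD A_real B_real
    by (intro eq_matI) (auto simp: Q_def Re_mat_def complex_is_Real_iff complex_eq_iff)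
  moreover have "Im_mat Q = B"
    using ABCD A_real B_real
    by (intro eq_matI) (auto simp: Q_def Im_mat_def complex_is_Real_iff complex_eq_iff)
  moreover have "C = - B" "D = A"
    using ABCD C D by (auto intro!: eq_matI)
  ultimately have "X = realify Q" by (simp add: X realify_def)
  moreover from this have "Q \<in> unitary_matrices m"
    using Xo by (simp add: realify_real_orthogonal_iff[OF Q])
  ultimately show "X \<in> realified_unitary m" by (simp add: realified_unitary_eq)
next
  let ?K = "realify (z \<cdot>\<^sub>m 1\<^sub>m m)"
  have K: "?K \<in> carrier_mat (2 * m) (2 * m)" by (simp add: realify_carrier)
  fix X assume "X \<in> realified_unitary m"
  then obtain Q where X: "X = realify Q" and Q: "Q \<in> unitary_matrices m"
    by (auto simp: realified_unitary_eq)
  have Qc: "Q \<in> carrier_mat m m" using Q by (simp add: unitary_matrices_def)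
  have "(z \<cdot>\<^sub>m 1\<^sub>m m) * Q = Q * (z \<cdot>\<^sub>m 1\<^sub>m m)"
    by (simp only: scalar_mat_mult[OF Qc])
  then have "?K * X = X * ?K"
    unfolding X using Qc by (simp flip: realify_mult[of _ m m _ m])
  moreover have "X \<in> real_orthogonal (2 * m)" unfolding X realify_real_orthogonal_iff[OF Qc] by (rule Q)
  ultimately show "X \<in> real_isotropy ?K" by (simp add: real_isotropy_iff[OF K])
qed

lemma real_isotropy_scalar: "real_isotropy (c \<cdot>\<^sub>m 1\<^sub>m n) = real_orthogonal n"
proof -
  have "(c \<cdot>\<^sub>m 1\<^sub>m n) * X = X * (c \<cdot>\<^sub>m 1\<^sub>m n)" if "X \<in> real_orthogonal n" for X
    using that by (simp add: real_orthogonal_iff scalar_mat_mult[of _ n n])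
  then show ?thesis by (auto simp: real_isotropy_iff[of _ n])
qed

section \<open>Separation of blocks by their scalar invariants\<close>

text \<open>The invariants \<open>K + K\<^sup>T = t I\<close> and \<open>K\<^sup>T K = r I\<close> by which blocks are told apart.\<close>

definition scalar_parts :: "complex mat \<Rightarrow> complex \<Rightarrow> complex \<Rightarrow> bool" where
  "scalar_parts K t r \<longleftrightarrow> (\<exists>k. K \<in> carrier_mat k k \<and> K + K\<^sup>T = t \<cdot>\<^sub>m 1\<^sub>m k \<and> K\<^sup>T * K = r \<cdot>\<^sub>m 1\<^sub>m k)"

text \<open>A common intertwiner \<open>Y\<close> of matrices and transposes also intertwines \<open>K + K\<^sup>T\<close> with \<open>L + L\<^sup>T\<close> and
  \<open>K\<^sup>T K\<close> with \<open>L\<^sup>T L\<close>. For scalar invariants this reads \<open>t Y = t' Y\<close> and \<open>r Y = r' Y\<close>.\<close>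

lemma no_intertwiner_scalar_parts:
  assumes "scalar_parts K t r" "scalar_parts L t' r'" and ne: "t \<noteq> t' \<or> r \<noteq> r'"
  shows "no_intertwiner K L"
  unfolding no_intertwiner_def
proof (intro ballI impI)
  obtain k l where K: "K \<in> carrier_mat k k" "K + K\<^sup>T = t \<cdot>\<^sub>m 1\<^sub>m k" "K\<^sup>T * K = r \<cdot>\<^sub>m 1\<^sub>m k"
    and L: "L \<in> carrier_mat l l" "L + L\<^sup>T = t' \<cdot>\<^sub>m 1\<^sub>m l" "L\<^sup>T * L = r' \<cdot>\<^sub>m 1\<^sub>m l"
    using assms(1,2) unfolding scalar_parts_def by blast
  fix Y :: "complex mat" assume "Y \<in> carrier_mat (dim_row K) (dim_row L)"
  then have Y: "Y \<in> carrier_mat k l" using K L by simp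
  assume "K * Y = Y * L \<and> K\<^sup>T * Y = Y * L\<^sup>T"
  then have c: "K * Y = Y * L" "K\<^sup>T * Y = Y * L\<^sup>T" by auto
  have KT: "K\<^sup>T \<in> carrier_mat k k" and LT: "L\<^sup>T \<in> carrier_mat l l" using K L by auto
  note scalar = scalar_mat_mult[OF Y]
  have "(K + K\<^sup>T) * Y = Y * (L + L\<^sup>T)"
    unfolding add_mult_distrib_mat[OF K(1) KT Y] mult_add_distrib_mat[OF Y L(1) LT] c ..
  then have t: "t \<cdot>\<^sub>m Y = t' \<cdot>\<^sub>m Y" unfolding K L scalar .
  have "K\<^sup>T * K * Y = K\<^sup>T * (Y * L)"
    unfolding assoc_mult_mat[OF KT K(1) Y] c(1) ..
  also have "\<dots> = Y * (L\<^sup>T * L)"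
    unfolding assoc_mult_mat[OF KT Y L(1), symmetric] c(2) by (rule assoc_mult_mat[OF Y LT L(1)])
  finally have r: "r \<cdot>\<^sub>m Y = r' \<cdot>\<^sub>m Y" unfolding K L scalar .
  have "Y $$ (i,j) = 0" if "i < k" "j < l" for i j
    using arg_cong[OF t, of "\<lambda>Y. Y $$ (i,j)"] arg_cong[OF r, of "\<lambda>Y. Y $$ (i,j)"] that Y ne by auto
  then show "Y = 0\<^sub>m (dim_row K) (dim_row L)" using Y K L by (intro eq_matI) auto
qed

text \<open>Under \<open>\<rho>\<close> these invariants come from \<open>z + cnj z = 2 Re z\<close> and \<open>cnj z * z = |z|\<^sup>2\<close>.\<close>

lemma scalar_parts_realify:
  "scalar_parts (realify (z \<cdot>\<^sub>m 1\<^sub>m m)) (of_real (2 * Re z)) (of_real ((cmod z)\<^sup>2))"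
proof -
  let ?Z = "z \<cdot>\<^sub>m 1\<^sub>m m"
  have Z: "?Z \<in> carrier_mat m m" by simp
  have adj: "mat_adjoint ?Z = cnj z \<cdot>\<^sub>m 1\<^sub>m m"
    using adjoint_carrier[OF Z] by (intro eq_matI) (auto simp: adjoint_index[OF Z])
  have "?Z + cnj z \<cdot>\<^sub>m 1\<^sub>m m = of_real (2 * Re z) \<cdot>\<^sub>m 1\<^sub>m m"
    by (intro eq_matI) (auto simp: complex_add_cnj)
  moreover have "(cnj z \<cdot>\<^sub>m 1\<^sub>m m) * ?Z = of_real ((cmod z)\<^sup>2) \<cdot>\<^sub>m 1\<^sub>m m"
    unfolding complex_norm_square
    by (subst scalar_mat_mult[OF Z]) (intro eq_matI; simp add: mult.commute)
  ultimately show ?thesis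
    unfolding scalar_parts_def realify_adjoint[OF Z, symmetric] adj
    using realify_carrier[OF Z] realify_add[OF Z, of "cnj z \<cdot>\<^sub>m 1\<^sub>m m"]
      realify_mult[of "cnj z \<cdot>\<^sub>m 1\<^sub>m m" m m ?Z m]
    by (intro exI[of _ "2 * m"]) (simp add: realify_real_scalar del: of_real_mult of_real_power)
qed

lemma scalar_parts_scalar:
  "scalar_parts (of_real c \<cdot>\<^sub>m 1\<^sub>m n) (of_real (2 * c)) (of_real (c\<^sup>2))"
proof -
  have "(of_real c \<cdot>\<^sub>m 1\<^sub>m n)\<^sup>T = (of_real c \<cdot>\<^sub>m 1\<^sub>m n :: complex mat)" by (intro eq_matI) auto
  moreover have "(of_real c \<cdot>\<^sub>m 1\<^sub>m n) * (of_real c \<cdot>\<^sub>m 1\<^sub>m n) = (of_real (c\<^sup>2) \<cdot>\<^sub>m 1\<^sub>m n :: complex mat)"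
    by (subst scalar_mat_mult[of _ n n]) (auto intro!: eq_matI simp: power2_eq_square)
  moreover have "of_real c \<cdot>\<^sub>m 1\<^sub>m n + of_real c \<cdot>\<^sub>m 1\<^sub>m n = (of_real (2 * c) \<cdot>\<^sub>m 1\<^sub>m n :: complex mat)"
    by (intro eq_matI) auto
  ultimately show ?thesis unfolding scalar_parts_def by (intro exI[of _ n]) simp
qed

section \<open>Sorting the coordinates of repeated two-by-two blocks\<close>

lemma diag_block_mat_replicate_index:
  assumes B: "B \<in> carrier_mat d d" and "i < m * d" "j < m * d"
  shows "diag_block_mat (replicate m B) $$ (i,j) =
    (if i div d = j div d then B $$ (i mod d, j mod d) else 0)"
  using assms(2,3)
proof (induction m arbitrary: i j)
  case (Suc m)
  have d: "0 < d" using Suc.prems by (cases d) auto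
  let ?D = "diag_block_mat (replicate m B)"
  have D: "?D \<in> carrier_mat (m * d) (m * d)"
    using diag_block_mat_carrier[of "replicate m B"] B by (auto simp: sum_list_replicate)
  have block: "diag_block_mat (replicate (Suc m) B) $$ (i,j) =
      (if i < d then if j < d then B $$ (i,j) else 0 else if j < d then 0 else ?D $$ (i - d, j - d))"
    using B D Suc.prems by (simp add: Let_def)
  show ?case
    unfolding block using Suc.IH[of "i - d" "j - d"] Suc.prems d
    by (auto simp: le_div_geq le_mod_geq not_less)
qed simp

lemma realify_scalar_carrier: "realify (z \<cdot>\<^sub>m 1\<^sub>m m) \<in> carrier_mat (2 * m) (2 * m)"
  by (simp add: realify_carrier)

lemma realify_scalar_index:
  assumes "i < 2 * m" "j < 2 * m"
  shows "realify (z \<cdot>\<^sub>m 1\<^sub>m m) $$ (i,j) =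
    (if i mod m \<noteq> j mod m then 0 else if i < m \<longleftrightarrow> j < m then of_real (Re z)
     else if i < m then of_real (Im z) else of_real (- Im z))"
proof -
  have "k mod m = (if k < m then k else k - m)" if "k < 2 * m" for k
    using that by (auto simp: mod_if)
  then show ?thesis using assms by (auto simp: realify_scalar_eq)
qed

text \<open>The permutation sends the two coordinates \<open>2k\<close> and \<open>2k + 1\<close> of the \<open>k\<close>-th small block to \<open>k\<close> and
  \<open>k + m\<close>.\<close>

lemma perm_similar_realify_scalar:
  "perm_similar (diag_block_mat (replicate m (realify (z \<cdot>\<^sub>m 1\<^sub>m 1)))) (realify (z \<cdot>\<^sub>m 1\<^sub>m m))"
proof -
  let ?B = "realify (z \<cdot>\<^sub>m 1\<^sub>m 1)"
  have B: "?B \<in> carrier_mat 2 2" using realify_carrier[of "z \<cdot>\<^sub>m 1\<^sub>m 1" 1 1] by simp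
  define p where "p i = (if i < 2 * m then i div 2 + (if odd i then m else 0) else i)" for i
  have p_even: "p (2 * k) = k" "p (Suc (2 * k)) = k + m" if "k < m" for k
    using that by (auto simp: p_def)
  have cases: "\<exists>k<m. i = 2 * k \<or> i = Suc (2 * k)" if "i < 2 * m" for i
    using that by (intro exI[of _ "i div 2"]) presburger
  have "p permutes {..<2 * m}"
  proof (rule permutes_lessThanI)
    show "inj_on p {..<2 * m}"
    proof (rule inj_onI)
      fix i j assume ij: "i \<in> {..<2 * m}" "j \<in> {..<2 * m}" "p i = p j"
      with cases[of i] cases[of j] show "i = j" by (auto simp: p_even)
    qed
    show "p i < 2 * m" if "i < 2 * m" for i
      using cases[OF that] by (auto simp: p_even)
  qed (simp add: p_def)
  moreover have "diag_block_mat (replicate m ?B) $$ (i,j) = realify (z \<cdot>\<^sub>m 1\<^sub>m m) $$ (p i, p j)"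
    if ij: "i < 2 * m" "j < 2 * m" for i j
  proof -
    obtain k l where k: "k < m" "i = 2 * k \<or> i = Suc (2 * k)" and l: "l < m" "j = 2 * l \<or> j = Suc (2 * l)"
      using cases[OF ij(1)] cases[OF ij(2)] by blast
    have D: "diag_block_mat (replicate m ?B) $$ (i,j) = (if i div 2 = j div 2 then ?B $$ (i mod 2, j mod 2) else 0)"
      using ij by (intro diag_block_mat_replicate_index[OF B]) auto
    have B_index: "?B $$ (a,b) = (if a = b then of_real (Re z) else if a = 0 then of_real (Im z) else of_real (- Im z))"
      if "a < 2" "b < 2" for a b
      using that by (subst realify_scalar_index) auto
    show ?thesis
      unfolding D using k l by (auto simp: p_even B_index realify_scalar_index)
  qed
  moreover have "diag_block_mat (replicate m ?B) \<in> carrier_mat (2 * m) (2 * m)"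
    using diag_block_mat_carrier[of "replicate m ?B"] B by (auto simp: sum_list_replicate mult.commute)
  ultimately show ?thesis
    using realify_carrier[of "z \<cdot>\<^sub>m 1\<^sub>m m" m m] unfolding perm_similar_def by auto
qed

section \<open>The two normal forms\<close>

text \<open>The common generalisation of both parts. The hypothesis on \<open>z\<close> says that the pairs
  \<open>(2 Re z, |z|\<^sup>2)\<close> of different blocks differ. They also differ from the pairs \<open>(2 c, c\<^sup>2)\<close> of the
  scalar blocks, since \<open>|z| > |Re z|\<close> for nonreal \<open>z\<close>.\<close>

theorem real_isotropy_normal_form:
  fixes z :: "nat \<Rightarrow> complex" and m :: "nat \<Rightarrow> nat" and js :: "nat list" and cs :: "(real \<times> nat) list"
  defines "K \<equiv> diag_block_mat (map (\<lambda>j. diag_block_mat (replicate (m j) (realify (z j \<cdot>\<^sub>m 1\<^sub>m 1)))) js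
      @ map (\<lambda>(c, k). of_real c \<cdot>\<^sub>m 1\<^sub>m k) cs)"
    and "T \<equiv> set_direct_sum (map (\<lambda>j. realified_unitary (m j)) js @ map (\<lambda>(c, k). real_orthogonal k) cs)"
    and "U \<equiv> set_direct_sum (map (\<lambda>j. unitary_matrices (m j)) js @ map (\<lambda>(c, k). real_orthogonal k) cs)"
    and "n \<equiv> (\<Sum>j\<leftarrow>js. 2 * m j) + (\<Sum>(c, k)\<leftarrow>cs. k)"
  assumes nonreal: "\<And>j. j \<in> set js \<Longrightarrow> Im (z j) \<noteq> 0"
    and sep: "sorted_wrt (\<lambda>i j. Re (z i) \<noteq> Re (z j) \<or> cmod (z i) \<noteq> cmod (z j)) js"
    and dist: "distinct (map fst cs)"
  shows "permutation_conjugate n (isotropy n K \<inter> real_orthogonal n) T \<and> T \<subseteq> real_matrices n \<and>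
    matrix_group n (isotropy n K \<inter> real_orthogonal n) \<cong> matrix_group k U"
proof -
  define Ls where "Ls = map (\<lambda>j. realify (z j \<cdot>\<^sub>m 1\<^sub>m (m j))) js @
    map (\<lambda>(c, k). of_real c \<cdot>\<^sub>m 1\<^sub>m k) cs"
  have sim: "perm_similar K (diag_block_mat Ls)"
    unfolding K_def Ls_def
    by (intro perm_similar_diag_block_mat list_all2_appendI)
       (auto simp: list_all2_map1 list_all2_map2 list_all2_same perm_similar_realify_scalar simp del: One_nat_def intro!: perm_similar_refl)
  have sq: "\<forall>L\<in>set Ls. square_mat L"
    using carrier_matD[OF realify_scalar_carrier] by (auto simp: Ls_def)
  have "sorted_wrt no_intertwiner Ls"
    unfolding Ls_def sorted_wrt_append
  proof (intro conjI ballI)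
    show "sorted_wrt no_intertwiner (map (\<lambda>j. realify (z j \<cdot>\<^sub>m 1\<^sub>m (m j))) js)"
      unfolding sorted_wrt_map
    proof (rule sorted_wrt_mono_rel[OF _ sep])
      fix i j assume "Re (z i) \<noteq> Re (z j) \<or> cmod (z i) \<noteq> cmod (z j)"
      then show "no_intertwiner (realify (z i \<cdot>\<^sub>m 1\<^sub>m (m i))) (realify (z j \<cdot>\<^sub>m 1\<^sub>m (m j)))"
        by (intro no_intertwiner_scalar_parts[OF scalar_parts_realify scalar_parts_realify])
           (auto simp del: of_real_mult of_real_power)
    qed
    have "sorted_wrt (\<lambda>x y. fst x \<noteq> fst y) cs"
      using dist unfolding distinct_conv_nth sorted_wrt_iff_nth_less by fastforce
    then show "sorted_wrt no_intertwiner (map (\<lambda>(c, k). of_real c \<cdot>\<^sub>m 1\<^sub>m k) cs)"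
      unfolding sorted_wrt_map
    proof (rule sorted_wrt_mono_rel[rotated])
      fix x y :: "real \<times> nat" assume "fst x \<noteq> fst y"
      then show "no_intertwiner (case x of (c, k) \<Rightarrow> of_real c \<cdot>\<^sub>m 1\<^sub>m k) (case y of (c, k) \<Rightarrow> of_real c \<cdot>\<^sub>m 1\<^sub>m k)"
        by (cases x; cases y)
           (auto intro!: no_intertwiner_scalar_parts[OF scalar_parts_scalar scalar_parts_scalar])
    qed
    fix X Y :: "complex mat" assume "X \<in> set (map (\<lambda>j. realify (z j \<cdot>\<^sub>m 1\<^sub>m (m j))) js)"
      and "Y \<in> set (map (\<lambda>(c, k). of_real c \<cdot>\<^sub>m 1\<^sub>m k) cs)"
    then obtain j c k where j: "j \<in> set js" and X: "X = realify (z j \<cdot>\<^sub>m 1\<^sub>m (m j))"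
      and Y: "Y = of_real c \<cdot>\<^sub>m 1\<^sub>m k" by auto
    have "Re (z j) \<noteq> c \<or> (cmod (z j))\<^sup>2 \<noteq> c\<^sup>2"
      using nonreal[OF j] by (auto simp: cmod_power2)
    then show "no_intertwiner X Y"
      unfolding X Y
      by (intro no_intertwiner_scalar_parts[OF scalar_parts_realify scalar_parts_scalar])
         (auto simp del: of_real_mult of_real_power)
  qed
  then have "real_isotropy (diag_block_mat Ls) = set_direct_sum (map real_isotropy Ls)"
    by (rule real_isotropy_diag_block_mat[OF sq])
  also have "map real_isotropy Ls =
      map (\<lambda>j. realified_unitary (m j)) js @ map (\<lambda>(c, k). real_orthogonal k) cs"
    by (auto simp: Ls_def nonreal real_isotropy_realify_scalar real_isotropy_scalar)
  finally have T: "real_isotropy (diag_block_mat Ls) = T" by (simp only: T_def)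
  have "dim_row (diag_block_mat Ls) = n"
    unfolding dim_diag_block_mat Ls_def n_def
    using carrier_matD(1)[OF realify_scalar_carrier] by (simp add: o_def split_def)
  moreover have "dim_row K = dim_row (diag_block_mat Ls)"
    using sim by (auto simp: perm_similar_def)
  ultimately have n: "dim_row K = n" by simp
  then have G: "isotropy n K \<inter> real_orthogonal n = real_isotropy K"
    by (simp add: real_isotropy_def)
  have "mult_iso T U"
    unfolding T_def U_def
  proof (rule conjunct1[OF mult_iso_set_direct_sum], rule list_all2_appendI)
    let ?R = "\<lambda>S T. mult_iso S T \<and> (\<exists>s. S \<subseteq> carrier_mat s s) \<and> (\<exists>t. T \<subseteq> carrier_mat t t)"
    have "?R (realified_unitary i) (unitary_matrices i)" "?R (real_orthogonal i) (real_orthogonal i)" for i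
      using mult_iso_realified_unitary mult_iso_refl realified_unitary_carrier unitary_matrices_carrier
        real_orthogonal_carrier by blast+
    then show "list_all2 ?R (map (\<lambda>j. realified_unitary (m j)) js) (map (\<lambda>j. unitary_matrices (m j)) js)"
      "list_all2 ?R (map (\<lambda>(c, k). real_orthogonal k) cs) (map (\<lambda>(c, k). real_orthogonal k) cs)"
      by (simp_all add: list_all2_map1 list_all2_map2 list_all2_same split_def)
  qed
  then show ?thesis
    unfolding G matrix_group_iso_iff
    using permutation_conjugate_real_isotropy[OF sim n] mult_iso_trans unfolding T by blast
qed

text \<open>The small blocks of both normal forms are \<open>\<rho>(z)\<close> for one-by-one matrices \<open>z\<close>.\<close>

lemma two_by_two_eq_realify:
  "mat_of_rows_list 2 [[of_real (Re z), of_real (Im z)], [- of_real (Im z), of_real (Re z)]] =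
    realify (z \<cdot>\<^sub>m 1\<^sub>m 1)"
proof (rule eq_matI)
  note C = realify_scalar_carrier[of z 1, unfolded mult_1_right]
  show "mat_of_rows_list 2 [[of_real (Re z), of_real (Im z)], [- of_real (Im z), of_real (Re z)]] $$ (i,j) =
      realify (z \<cdot>\<^sub>m 1\<^sub>m 1) $$ (i,j)"
    if "i < dim_row (realify (z \<cdot>\<^sub>m 1\<^sub>m 1))" "j < dim_col (realify (z \<cdot>\<^sub>m 1\<^sub>m 1))" for i j
  proof -
    have ij: "i < 2" "j < 2" using that C by auto
    then have "realify (z \<cdot>\<^sub>m 1\<^sub>m 1) $$ (i,j) =
        (if i = j then of_real (Re z) else if i = 0 then of_real (Im z) else of_real (- Im z))"
      by (subst realify_scalar_index) auto
    with ij show ?thesis by (auto simp: mat_of_rows_list_def less_2_cases_iff)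
  qed
qed (use realify_scalar_carrier[of z 1] in \<open>auto simp: mat_of_rows_list_def\<close>)

lemma skew_block_eq: "skew_block s = realify (Complex 0 s \<cdot>\<^sub>m 1\<^sub>m 1)"
  using two_by_two_eq_realify[of "Complex 0 s"] by (simp add: skew_block_def)

lemma rotation_block_eq: "rotation_block t = realify (cis t \<cdot>\<^sub>m 1\<^sub>m 1)"
  using two_by_two_eq_realify[of "cis t"] by (simp add: rotation_block_def)

lemma cos_eq_imp:
  fixes x y :: real
  assumes "cos x = cos y"
  obtains k :: int where "x = y + 2 * pi * of_int k \<or> x = - y + 2 * pi * of_int k"
proof -
  have "sin ((x + y) / 2) = 0 \<or> sin ((y - x) / 2) = 0"
    using assms cos_diff_cos[of x y] by simp
  then obtain k :: int where "(x + y) / 2 = of_int k * pi \<or> (y - x) / 2 = of_int k * pi"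
    by (auto simp: sin_zero_iff_int2)
  then have "x = - y + 2 * pi * of_int k \<or> x = y + 2 * pi * of_int (- k)"
    by (auto simp: field_simps)
  then show ?thesis using that by blast
qed

theorem corollary2p7:
  fixes N M M1 M2 :: nat and m :: "nat \<Rightarrow> nat" and \<sigma> \<phi> :: "nat \<Rightarrow> real"
  assumes m_pos: "\<forall>j\<in>{1..N}. m j > 0"
  shows
    "((\<forall>j\<in>{1..N}. \<sigma> j \<noteq> 0) \<and> distinct_skew_parameters N \<sigma> \<longrightarrow>
       (let n = M + (\<Sum>j = 1..N. 2 * m j);
            G = isotropy n (skew_normal_form N m \<sigma> M) \<inter> real_orthogonal n;
            T = set_direct_sum (map (\<lambda>j. realified_unitary (m j)) [1..<Suc N] @ [real_orthogonal M]);
            U = set_direct_sum (map (\<lambda>j. unitary_matrices (m j)) [1..<Suc N] @ [real_orthogonal M])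
        in permutation_conjugate n G T \<and> T \<subseteq> real_matrices n \<and>
           matrix_group n G \<cong> matrix_group (M + (\<Sum>j = 1..N. m j)) U))
     \<and>
     ((\<forall>j\<in>{1..N}. \<forall>k::int. \<phi> j \<noteq> of_int k * pi) \<and> distinct_rotation_angles N \<phi> \<longrightarrow>
       (let n = M1 + M2 + (\<Sum>j = 1..N. 2 * m j);
            G = isotropy n (orthogonal_normal_form N m \<phi> M1 M2) \<inter> real_orthogonal n;
            T = set_direct_sum (map (\<lambda>j. realified_unitary (m j)) [1..<Suc N]
                  @ [real_orthogonal M1, real_orthogonal M2]);
            U = set_direct_sum (map (\<lambda>j. unitary_matrices (m j)) [1..<Suc N]
                  @ [real_orthogonal M1, real_orthogonal M2])
        in permutation_conjugate n G T \<and> T \<subseteq> real_matrices n \<and>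
           matrix_group n G \<cong> matrix_group (M1 + M2 + (\<Sum>j = 1..N. m j)) U))"
  (is "(?A1 \<longrightarrow> ?C1) \<and> (?A2 \<longrightarrow> ?C2)")
proof -
  let ?js = "[1..<Suc N]"
  have js: "set ?js = {1..N}" by (simp only: set_upt atLeastLessThanSuc_atLeastAtMost)
  have sum_js: "(\<Sum>j\<leftarrow>?js. f j) = (\<Sum>j = 1..N. f j)" for f :: "nat \<Rightarrow> nat"
    by (simp only: interv_sum_list_conv_sum_set_nat js)
  have sorted_js: "sorted_wrt Q ?js"
    if "\<And>i j. i \<in> {1..N} \<Longrightarrow> j \<in> {1..N} \<Longrightarrow> i \<noteq> j \<Longrightarrow> Q i j" for Q
    using that by (auto simp: sorted_wrt_iff_nth_less simp del: upt_Suc)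
  have ?C1 if A: ?A1
  proof -
    let ?z = "\<lambda>j. Complex 0 (\<sigma> j)"
    have nonreal: "Im (?z j) \<noteq> 0" if "j \<in> set ?js" for j
      using A that unfolding js by auto
    \<comment> \<open>Here all real parts are zero and the moduli \<open>|\<sigma> j|\<close> differ.\<close>
    have sep: "sorted_wrt (\<lambda>i j. Re (?z i) \<noteq> Re (?z j) \<or> cmod (?z i) \<noteq> cmod (?z j)) ?js"
      using A by (intro sorted_js) (auto simp: distinct_skew_parameters_def complex_norm abs_eq_iff)
    have dim: "(\<Sum>j\<leftarrow>?js. 2 * m j) + (\<Sum>(c, k)\<leftarrow>[(0 :: real, M)]. k) = M + (\<Sum>j = 1..N. 2 * m j)"
      unfolding sum_js by simp
    have dist: "distinct (map fst [(0 :: real, M)])" by simp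
    have zero: "of_real 0 \<cdot>\<^sub>m 1\<^sub>m M = (0\<^sub>m M M :: complex mat)" by (intro eq_matI) auto
    from real_isotropy_normal_form[where z = ?z and js = ?js and cs = "[(0, M)]" and m = m
        and k = "M + (\<Sum>j = 1..N. m j)", OF nonreal sep dist]
    show ?thesis
      unfolding dim
      unfolding list.map prod.case zero skew_block_eq[symmetric] skew_normal_form_def[symmetric] Let_def .
  qed
  moreover have ?C2 if A: ?A2
  proof -
    let ?z = "\<lambda>j. cis (\<phi> j)"
    have nonreal: "Im (?z j) \<noteq> 0" if "j \<in> set ?js" for j
      using A that unfolding js by (auto simp: sin_zero_iff_int2)
    \<comment> \<open>All numbers \<open>cis (\<phi> j)\<close> have modulus one; it is the real parts that differ.\<close>
    have "cos (\<phi> i) \<noteq> cos (\<phi> j)" if "i \<in> {1..N}" "j \<in> {1..N}" "i \<noteq> j" for i j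
      using A that unfolding distinct_rotation_angles_def by (metis cos_eq_imp)
    then have sep: "sorted_wrt (\<lambda>i j. Re (?z i) \<noteq> Re (?z j) \<or> cmod (?z i) \<noteq> cmod (?z j)) ?js"
      by (intro sorted_js) auto
    have dim: "(\<Sum>j\<leftarrow>?js. 2 * m j) + (\<Sum>(c, k)\<leftarrow>[(1 :: real, M1), (- 1, M2)]. k) =
        M1 + M2 + (\<Sum>j = 1..N. 2 * m j)"
      unfolding sum_js by simp
    have dist: "distinct (map fst [(1 :: real, M1), (- 1, M2)])" by simp
    have one: "of_real 1 \<cdot>\<^sub>m 1\<^sub>m M1 = (1\<^sub>m M1 :: complex mat)"
      "of_real (- 1) \<cdot>\<^sub>m 1\<^sub>m M2 = (- 1\<^sub>m M2 :: complex mat)"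
      by (auto intro!: eq_matI)
    from real_isotropy_normal_form[where z = ?z and js = ?js and cs = "[(1, M1), (- 1, M2)]" and m = m
        and k = "M1 + M2 + (\<Sum>j = 1..N. m j)", OF nonreal sep dist]
    show ?thesis
      unfolding dim
      unfolding list.map prod.case one rotation_block_eq[symmetric] orthogonal_normal_form_def[symmetric] Let_def .
  qed
  ultimately show ?thesis by blast
qed

end
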